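(* Let $X$ be a complex Hilbert space and let $(U(t,s))_{t\ge s\ge0}$ be an evolution family on $X$, associated with a non-autonomous Cauchy problem $\dot z(t)=A(t)z(t)$, $t\ge0$, $z(0)=x$, so that for $x\in X$ the solution with initial value $x$ is $z(t)=U(t,0)x$, $t\ge0$. Suppose that $(U(t,s))_{t\ge s\ge0}$ is bounded and $\tau$-periodic for some $\tau>0$. Let $T=U(\tau,0)$ be the monodromy operator, and suppose that $\sigma(T)\cap\mathbb{T}\subseteq\{1\}$ and that $$\|R(e^{i\theta},T)\|=O(|\theta|^{-\alpha}),\quad \theta\to0,$$ for some $\alpha\ge1$. Then $X=\operatorname{Fix} T\oplus Z$, where $Z$ denotes the closure of $\operatorname{Ran}(I-T)$. Let $P$ denote the projection onto $\operatorname{Fix}T$ along $Z$. Then the following hold. (i) For any initial value $x\in X$ the solution $z$ satisfies $$\|z(t)-z_0(t)\|\to0,\quad t\to\infty,$$ where $z_0\colon\mathbb{R}_+\to X$ is the $\tau$-periodic solution with initial condition $z_0(0)=Px$, that is, $z_0(t)=U(t,0)Px$, $t\ge0$. In particular, the system is asymptotically periodic, and it is stable if and only if $\operatorname{Fix}T=\{0\}$. (ii) There exist $M,\beta>0$ such that $$\|z(t)-z_0(t)\|\le Me^{-\beta t}\|x\|,\quad t\ge0,\ x\in X,$$ if and only if $\operatorname{Ran}(I-T)$ is closed. (iii) In any case, if $x\in X$ is such that $x-Px\in\operatorname{Ran}\big((I-T)^\gamma\big)$ for some $\gamma>0$, then $$\|z(t)-z_0(t)\|=o(t^{-\gamma/\alpha}),\quad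 t\to\infty.$$ (iv) There exists a dense subspace $X_0$ of $X$ such that for all $x\in X_0$ the convergence $\|z(t)-z_0(t)\|\to0$ is superpolynomially fast, that is, $\|z(t)-z_0(t)\|=o(t^{-\gamma})$ as $t\to\infty$ for all $\gamma>0$.
   Context: An evolution family on $X$ is a family $(U(t,s))_{t\ge s\ge0}$ of bounded linear operators on $X$ such that $U(t,t)=I$ for $t\ge0$, $U(t,r)U(r,s)=U(t,s)$ for $t\ge r\ge s\ge0$, and $(t,s)\mapsto U(t,s)x$ is continuous on $\{(t,s):t\ge s\ge0\}$ for every $x\in X$. It is bounded if $\sup_{t\ge s\ge0}\|U(t,s)\|<\infty$, and $\tau$-periodic if $U(t+\tau,s+\tau)=U(t,s)$ for all $t\ge s\ge0$. The "solution" with initial value $x$ is by definition the function $z(t)=U(t,0)x$, $t\ge0$. The system is asymptotically periodic if for every $x\in X$ there is a periodic function $z_0\colon\mathbb{R}_+\to X$ with $\|z(t)-z_0(t)\|\to0$ as $t\to\infty$; it is stable if $\|z(t)\|\to0$ as $t\to\infty$ for every $x\in X$. Notation: $\operatorname{Fix}T=\operatorname{Ker}(I-T)$; $\mathbb{T}=\{\lambda\in\mathbb{C}:|\lambda|=1\}$; $\sigma(T)$ is the spectrum; $R(\lambda,T)=(\lambda-T)^{-1}$ for $\lambda\notin\sigma(T)$. Since $T$ is power-bounded, $I-T$ is a sectorial operator of angle at most $\pi/2$, and $(I-T)^\gamma$, $\gamma\ge0$, denotes its fractional power. *)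

theory Defs
  imports "HOL-Analysis.Analysis" "HOL-Library.Landau_Symbols"
begin

section \<open>Complex Hilbert spaces\<close>

class complex_vector = real_vector +
  fixes scaleC :: "complex \<Rightarrow> 'a \<Rightarrow> 'a" (infixr \<open>*\<^sub>C\<close> 75)
  assumes scaleC_add_right: "a *\<^sub>C (x + y) = a *\<^sub>C x + a *\<^sub>C y"
    and scaleC_add_left: "(a + b) *\<^sub>C x = a *\<^sub>C x + b *\<^sub>C x"
    and scaleC_scaleC: "a *\<^sub>C (b *\<^sub>C x) = (a * b) *\<^sub>C x"
    and scaleC_one: "1 *\<^sub>C x = x"
    and scaleR_eq_scaleC: "r *\<^sub>R x = complex_of_real r *\<^sub>C x"

global_interpretation complex_vector: vector_space "scaleC :: complex \<Rightarrow> 'a \<Rightarrow> 'a::complex_vector"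
  by unfold_locales (simp_all add: scaleC_add_right scaleC_add_left scaleC_scaleC scaleC_one)

text \<open>The norm of a complex inner product space is inherited from \<^class>\<open>real_inner\<close>,
  so that it equals the square root of \<open>cinner x x\<close>.\<close>

class complex_inner = complex_vector + real_inner +
  fixes cinner :: "'a \<Rightarrow> 'a \<Rightarrow> complex"
  assumes cinner_add_left: "cinner (x + y) z = cinner x z + cinner y z"
    and cinner_scaleC_left: "cinner (a *\<^sub>C x) y = a * cinner x y"
    and cinner_commute: "cinner x y = cnj (cinner y x)"
    and Re_cinner: "Re (cinner x y) = inner x y"

lemma norm_eq_sqrt_cinner: "norm x = sqrt (Re (cinner x x))" for x :: "'a::complex_inner"
  by (simp add: Re_cinner norm_eq_sqrt_inner)

class complex_hilbert_space = complex_inner + complete_space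

instantiation complex :: complex_hilbert_space
begin

definition scaleC_complex :: "complex \<Rightarrow> complex \<Rightarrow> complex"
  where "scaleC_complex a x = a * x"

definition cinner_complex :: "complex \<Rightarrow> complex \<Rightarrow> complex"
  where "cinner_complex x y = x * cnj y"

instance
  by standard (simp_all add: scaleC_complex_def cinner_complex_def algebra_simps
      inner_complex_def scaleR_conv_of_real)

end


section \<open>Bounded operators\<close>

definition bounded_clinear :: "('a::complex_inner \<Rightarrow> 'b::complex_inner) \<Rightarrow> bool"
  where "bounded_clinear f \<longleftrightarrow> bounded_linear f \<and> (\<forall>c x. f (c *\<^sub>C x) = c *\<^sub>C f x)"

definition spectrum :: "('a::complex_inner \<Rightarrow> 'a) \<Rightarrow> complex set"
  where "spectrum T = {\<mu>. \<not> (\<exists>S. bounded_clinear S \<and>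
    (\<forall>x. S (\<mu> *\<^sub>C x - T x) = x) \<and> (\<forall>x. \<mu> *\<^sub>C S x - T (S x) = x))}"

text \<open>The resolvent; meaningful only for \<open>\<mu> \<notin> spectrum T\<close>.\<close>

definition resolvent :: "complex \<Rightarrow> ('a::complex_inner \<Rightarrow> 'a) \<Rightarrow> 'a \<Rightarrow> 'a"
  where "resolvent \<mu> T = inv (\<lambda>x. \<mu> *\<^sub>C x - T x)"

definition Fix :: "('a::complex_inner \<Rightarrow> 'a) \<Rightarrow> 'a set"
  where "Fix T = {x. x - T x = 0}"

text \<open>Fractional powers \<open>A\<^sup>\<gamma>\<close>, \<open>\<gamma> \<ge> 0\<close>, of a bounded sectorial operator, in the sense of
  Balakrishnan: \<open>A\<^sup>\<gamma> = A\<^sup>n A\<^sup>\<delta>\<close> with \<open>n\<close> the integer part and \<open>\<delta>\<close> the fractional part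
  of \<open>\<gamma>\<close>, where \<open>A\<^sup>0 = I\<close> and, for \<open>0 < \<delta> < 1\<close>,
  \<open>A\<^sup>\<delta> x = (sin (\<pi> \<delta>) / \<pi>) \<integral> s\<^bsup>\<delta> - 1\<^esup> (s + A)\<^sup>-\<^sup>1 A x ds\<close> over \<open>0 < s < \<infinity>\<close>.
  Sectoriality bounds \<open>s (s + A)\<^sup>-\<^sup>1\<close> uniformly in \<open>s > 0\<close>, so the integrand is continuous with
  norm \<open>O(s\<^bsup>\<delta> - 1\<^esup>)\<close> at 0 and \<open>O(s\<^bsup>\<delta> - 2\<^esup>)\<close> at infinity, and the integral converges absolutely.\<close>

definition balakrishnan :: "('a::complex_hilbert_space \<Rightarrow> 'a) \<Rightarrow> real \<Rightarrow> 'a \<Rightarrow> 'a"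
  where "balakrishnan A \<delta> x = (sin (pi * \<delta>) / pi) *\<^sub>R
    integral {0<..} (\<lambda>s. s powr (\<delta> - 1) *\<^sub>R inv (\<lambda>y. s *\<^sub>R y + A y) (A x))"

definition frac_power :: "('a::complex_hilbert_space \<Rightarrow> 'a) \<Rightarrow> real \<Rightarrow> 'a \<Rightarrow> 'a"
  where "frac_power A \<gamma> x =
    (A ^^ nat \<lfloor>\<gamma>\<rfloor>) (if frac \<gamma> = 0 then x else balakrishnan A (frac \<gamma>) x)"


section \<open>Direct sums and projections\<close>

definition direct_sum_decomp :: "'a::complex_inner set \<Rightarrow> 'a set \<Rightarrow> bool"
  where "direct_sum_decomp M N \<longleftrightarrow>
    complex_vector.subspace M \<and> closed M \<and> complex_vector.subspace N \<and> closed N \<and>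
    M \<inter> N = {0} \<and> (\<forall>x. \<exists>m\<in>M. \<exists>n\<in>N. x = m + n)"

definition proj_along :: "'a::complex_inner set \<Rightarrow> 'a set \<Rightarrow> 'a \<Rightarrow> 'a"
  where "proj_along M N x = (THE m. m \<in> M \<and> x - m \<in> N)"


section \<open>Evolution families\<close>

text \<open>Only the values \<open>U t s\<close> with \<open>t \<ge> s \<ge> 0\<close> are relevant.\<close>

definition evolution_family :: "(real \<Rightarrow> real \<Rightarrow> 'a::complex_inner \<Rightarrow> 'a) \<Rightarrow> bool"
  where "evolution_family U \<longleftrightarrow>
    (\<forall>t s. 0 \<le> s \<and> s \<le> t \<longrightarrow> bounded_clinear (U t s)) \<and>
    (\<forall>t\<ge>0. U t t = id) \<and>
    (\<forall>t r s. 0 \<le> s \<and> s \<le> r \<and> r \<le> t \<longrightarrow> U t r \<circ> U r s = U t s) \<and>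
    (\<forall>x. continuous_on {(t, s). 0 \<le> s \<and> s \<le> t} (\<lambda>(t, s). U t s x))"

definition bounded_family :: "(real \<Rightarrow> real \<Rightarrow> 'a::complex_inner \<Rightarrow> 'a) \<Rightarrow> bool"
  where "bounded_family U \<longleftrightarrow> bdd_above {onorm (U t s) | t s. 0 \<le> s \<and> s \<le> t}"

definition periodic_family :: "real \<Rightarrow> (real \<Rightarrow> real \<Rightarrow> 'a \<Rightarrow> 'a) \<Rightarrow> bool"
  where "periodic_family \<tau> U \<longleftrightarrow> (\<forall>t s. 0 \<le> s \<and> s \<le> t \<longrightarrow> U (t + \<tau>) (s + \<tau>) = U t s)"

definition solution :: "(real \<Rightarrow> real \<Rightarrow> 'a \<Rightarrow> 'a) \<Rightarrow> 'a \<Rightarrow> real \<Rightarrow> 'a"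
  where "solution U x t = U t 0 x"

text \<open>Functions on the half-line are modelled by functions on \<^typ>\<open>real\<close> of which only the values
  at \<open>t \<ge> 0\<close> are considered.\<close>

definition periodic_with :: "real \<Rightarrow> (real \<Rightarrow> 'a) \<Rightarrow> bool"
  where "periodic_with p f \<longleftrightarrow> p > 0 \<and> (\<forall>t\<ge>0. f (t + p) = f t)"

definition asymptotically_periodic :: "(real \<Rightarrow> real \<Rightarrow> 'a::complex_inner \<Rightarrow> 'a) \<Rightarrow> bool"
  where "asymptotically_periodic U \<longleftrightarrow>
    (\<forall>x. \<exists>z\<^sub>0. (\<exists>p. periodic_with p z\<^sub>0) \<and> ((\<lambda>t. norm (solution U x t - z\<^sub>0 t)) \<longlongrightarrow> 0) at_top)"

definition stable :: "(real \<Rightarrow> real \<Rightarrow> 'a::complex_inner \<Rightarrow> 'a) \<Rightarrow> bool"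
  where "stable U \<longleftrightarrow> (\<forall>x. ((\<lambda>t. norm (solution U x t)) \<longlongrightarrow> 0) at_top)"

end

theory Submission
  imports Defs
begin

text \<open>
  Write \<open>A = I - T\<close> and let \<open>K\<close> bound all \<open>\<parallel>U(t,s)\<parallel>\<close>, so that \<open>\<parallel>T\<^sup>n\<parallel> \<le> K\<close> for all \<open>n\<close>. Over whole
  periods the solution is \<open>T\<^sup>n x\<close>, and inside a period it grows by at most the factor \<open>K\<close>; hence all
  assertions are about the orbits \<open>T\<^sup>n (x - P x)\<close>. They all follow from one estimate,
  \<open>\<parallel>T\<^sup>n A\<parallel> = O(n\<^bsup>-1/\<alpha>\<^esup>)\<close> (\<open>Katznelson_Tzafriri_rate\<close>).

  The estimate rests on Parseval's identity for vectors in a Hilbert space.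
  Suppose that \<open>B\<close> commutes with \<open>T\<close> and \<open>\<parallel>R(\<mu>,T) B\<parallel> \<le> M\<close> on the unit circle without \<open>1\<close>. On sequences of
  vectors, convolution with \<open>(T\<^sup>l B)\<close> is essentially the Fourier multiplier \<open>R(\<mu>,T) B\<close>; applied to a sequence of
  the form \<open>(d\<^sub>l T\<^sup>l x)\<close>, with scalars \<open>\<bar>d\<^sub>l\<bar> \<le> 1\<close>, it gives \<open>\<parallel>T\<^sup>n B\<parallel> \<le> const \<sqdot> M / n\<close>
  (\<open>decay_of_multiplier\<close>). It suffices to use finitely many frequencies, so only finite sums occur. The frequencies are
  the roots of \<open>-1\<close>, which avoid the singular point \<open>1\<close>.

  For \<open>B\<close> one takes \<open>A\<close> filtered by a Cesaro mean \<open>C\<^sub>m = (1/m) \<Sum>\<^bsub>k<m\<^esub> T\<^sup>k\<close>, namely \<open>B = A (I - C\<^sub>m)\<^sup>q\<close> with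
  \<open>q \<ge> \<alpha> - 1\<close>. The filter suppresses the frequencies \<open>\<bar>\<mu> - 1\<bar> < 1/m\<close> and makes \<open>M\<close> of size \<open>m\<^bsup>\<alpha>-1\<^esup>\<close>
  (\<open>multiplier_bound\<close>), while the discarded part \<open>A - B\<close> has norm \<open>O(1/m)\<close>. Choosing \<open>m\<close> close to
  \<open>n\<^bsup>1/\<alpha>\<^esup>\<close> balances the two contributions.

  The splitting of the space comes from almost fixed points of almost minimal norm (\<open>exists_Fix_component\<close>);
  since \<open>T\<^sup>n A \<rightarrow> 0\<close>, orbits tend to \<open>0\<close> on \<open>Z\<close>, and this gives (i). For (ii), if the range is closed then every
  \<open>z \<in> Z\<close> is some \<open>A y\<close>, so \<open>n\<^bsup>1/\<alpha>\<^esup> T\<^sup>n z\<close> is bounded for each \<open>z\<close>, hence uniformly, hence some power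
  of \<open>T\<close> is a strict contraction of \<open>Z\<close>; conversely a Neumann series inverts \<open>A\<close> on \<open>Z\<close>.
  For (iii), powers of the basic estimate give \<open>o(n\<^bsup>-k/\<alpha>\<^esup>)\<close> for integer \<open>k\<close>, and splitting Balakrishnan's integral
  at \<open>s = n\<^bsup>-1/\<alpha>\<^esup>\<close> interpolates between \<open>k\<close> and \<open>k + 1\<close> (\<open>balakrishnan_moment_bound\<close>). For (iv), a
  Mittag-Leffler construction shows that the vectors lying in the range of every power of \<open>A\<close> are dense in \<open>Z\<close>.
\<close>

section \<open>Complex scalars and bounded operators\<close>

lemma cinner_scaleC_right: "cinner x (a *\<^sub>C y) = cnj a * cinner x y"
  by (metis cinner_commute cinner_scaleC_left complex_cnj_mult)

lemma norm_scaleC: "norm (a *\<^sub>C x) = cmod a * norm (x::'a::complex_inner)"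
proof -
  have "cnj a * a = complex_of_real ((cmod a)\<^sup>2)"
    unfolding mult.commute[of "cnj a"] by (rule complex_norm_square[symmetric])
  then have "cinner (a *\<^sub>C x) (a *\<^sub>C x) = complex_of_real ((cmod a)\<^sup>2) * cinner x x"
    by (simp only: cinner_scaleC_left cinner_scaleC_right mult.assoc[symmetric])
  then have "Re (cinner (a *\<^sub>C x) (a *\<^sub>C x)) = (cmod a)\<^sup>2 * Re (cinner x x)"
    by simp
  then show ?thesis
    by (simp add: norm_eq_sqrt_cinner[of x] norm_eq_sqrt_cinner[of "a *\<^sub>C x"] real_sqrt_mult)
qed

lemma bounded_clinear_linear: "bounded_clinear f \<Longrightarrow> bounded_linear f"
  by (simp add: bounded_clinear_def)

lemma bounded_clinearI:
  assumes "\<And>x y. f (x + y) = f x + f y" and "\<And>c x. f (c *\<^sub>C x) = c *\<^sub>C f x"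
    and "\<And>x. norm (f x) \<le> b * norm x"
  shows "bounded_clinear f"
  unfolding bounded_clinear_def
proof (intro conjI allI)
  show "bounded_linear f"
    by (rule bounded_linear_intro[where K = b])
      (use assms in \<open>auto simp: scaleR_eq_scaleC mult.commute\<close>)
qed (rule assms)

lemma
  assumes "bounded_clinear f"
  shows bounded_clinear_add: "f (x + y) = f x + f y"
    and bounded_clinear_diff: "f (x - y) = f x - f y"
    and bounded_clinear_zero: "f 0 = 0"
    and bounded_clinear_sum: "f (sum g S) = (\<Sum>i\<in>S. f (g i))"
    and bounded_clinear_scaleR: "f (r *\<^sub>R x) = r *\<^sub>R f x"
    and bounded_clinear_scaleC: "f (c *\<^sub>C x) = c *\<^sub>C f x"
    and bounded_clinear_tendsto: "(h \<longlongrightarrow> l) F \<Longrightarrow> ((\<lambda>n. f (h n)) \<longlongrightarrow> f l) F"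
    and bounded_clinear_continuous: "continuous_on UNIV f"
proof -
  interpret bounded_linear f using assms by (rule bounded_clinear_linear)
  show "f (x + y) = f x + f y" "f (x - y) = f x - f y" "f 0 = 0" "f (sum g S) = (\<Sum>i\<in>S. f (g i))"
    "f (r *\<^sub>R x) = r *\<^sub>R f x" "(h \<longlongrightarrow> l) F \<Longrightarrow> ((\<lambda>n. f (h n)) \<longlongrightarrow> f l) F"
    by (rule add diff zero sum scaleR tendsto; assumption?)+
  show "f (c *\<^sub>C x) = c *\<^sub>C f x" using assms by (simp add: bounded_clinear_def)
  show "continuous_on UNIV f" by (simp add: linear_continuous_on assms bounded_clinear_linear)
qed

lemma bounded_clinear_scaleC_left: "bounded_clinear ((*\<^sub>C) a)"
  by (rule bounded_clinearI[where b = "cmod a"])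
    (simp_all add: scaleC_add_right scaleC_scaleC norm_scaleC mult.commute)

lemma bounded_clinear_compose:
  assumes "bounded_clinear f" "bounded_clinear g"
  shows "bounded_clinear (\<lambda>x. f (g x))"
  using assms by (simp add: bounded_clinear_def bounded_linear_compose)

lemma bounded_clinear_id: "bounded_clinear (\<lambda>x. x)"
  by (simp add: bounded_clinear_def)

lemma bounded_clinear_minus:
  assumes "bounded_clinear f" "bounded_clinear g"
  shows "bounded_clinear (\<lambda>x. f x - g x)"
  using assms by (simp add: bounded_clinear_def bounded_linear_sub complex_vector.scale_right_diff_distrib)

lemma bounded_clinear_funpow:
  fixes f :: "'a::complex_inner \<Rightarrow> 'a"
  assumes "bounded_clinear f"
  shows "bounded_clinear (f ^^ n)"
proof (induction n)
  case 0
  show ?case by (rule bounded_clinearI[where b = 1]) simp_all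
next
  case (Suc n)
  then show ?case using bounded_clinear_compose[OF assms Suc] by (simp add: comp_def)
qed

lemma bounded_clinear_fun_sum:
  assumes "\<And>i. i \<in> S \<Longrightarrow> bounded_clinear (f i)"
  shows "bounded_clinear (\<lambda>x. \<Sum>i\<in>S. f i x)"
  unfolding bounded_clinear_def
proof (intro conjI allI)
  show "bounded_linear (\<lambda>x. \<Sum>i\<in>S. f i x)"
    by (rule bounded_linear_sum) (use assms bounded_clinear_linear in auto)
  show "(\<Sum>i\<in>S. f i (c *\<^sub>C x)) = c *\<^sub>C (\<Sum>i\<in>S. f i x)" for c x
    unfolding complex_vector.scale_sum_right
    by (rule sum.cong) (use assms bounded_clinear_scaleC in auto)
qed

lemma bounded_clinear_fun_scaleR:
  assumes "bounded_clinear f"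
  shows "bounded_clinear (\<lambda>x. r *\<^sub>R f x)"
  using bounded_clinear_compose[OF bounded_clinear_scaleC_left assms, of "complex_of_real r"]
  by (simp add: scaleR_eq_scaleC)

subclass (in complex_hilbert_space) banach ..

section \<open>Parseval's identity on a finite cyclic group\<close>

text \<open>The \<open>N\<close>-th roots of \<open>-1\<close>. They serve as Fourier frequencies just as well as the roots of unity,
  but never equal \<open>1\<close>, the one point of the circle where the resolvent may be singular.\<close>

definition antiperiodic_node :: "nat \<Rightarrow> nat \<Rightarrow> complex"
  where "antiperiodic_node N j = cis (pi * (2 * real j + 1) / real N)"

lemma norm_antiperiodic_node: "norm (antiperiodic_node N j) = 1"
  by (simp add: antiperiodic_node_def)

lemma antiperiodic_node_power:
  assumes "N > 0"
  shows "antiperiodic_node N j ^ N = -1"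
proof -
  have "antiperiodic_node N j ^ N = cis (real N * (pi * (2 * real j + 1) / real N))"
    unfolding antiperiodic_node_def by (simp only: Complex.DeMoivre)
  also have "real N * (pi * (2 * real j + 1) / real N) = 2 * pi * real j + pi"
    using assms by (simp add: field_simps)
  also have "cis (2 * pi * real j + pi) = cis (2 * pi * real j) * cis pi"
    by (rule cis_mult[symmetric])
  also have "cis (2 * pi * real j) = 1"
    by (rule cis_multiple_2pi) simp
  finally show ?thesis by simp
qed

lemma antiperiodic_node_neq_1: "N > 0 \<Longrightarrow> antiperiodic_node N j \<noteq> 1"
  using antiperiodic_node_power[of N j] by (metis one_neq_neg_one power_one)

text \<open>Up to a common factor the terms are the powers of a nontrivial \<open>N\<close>-th root of unity \<open>\<omega>\<close>, so
  the sum is a complete geometric sum.\<close>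

lemma sum_antiperiodic_node:
  assumes "l < N" "m < N" "l \<noteq> m"
  shows "(\<Sum>j<N. antiperiodic_node N j ^ l * cnj (antiperiodic_node N j ^ m)) = 0"
proof -
  define d where "d = real l - real m"
  define \<omega> where "\<omega> = cis (2 * pi * d / N)"
  have N: "N > 0" using assms by simp
  have term_eq: "antiperiodic_node N j ^ l * cnj (antiperiodic_node N j ^ m) = cis (pi * d / N) * \<omega> ^ j" for j
    unfolding antiperiodic_node_def \<omega>_def d_def Complex.DeMoivre cis_cnj cis_mult
    using N by (intro arg_cong[where f = cis]) (simp add: field_simps)
  have "\<omega> ^ N = 1"
  proof -
    have "\<omega> ^ N = cis (real N * (2 * pi * d / N))" unfolding \<omega>_def by (simp only: Complex.DeMoivre)
    also have "real N * (2 * pi * d / N) = 2 * pi * d" using N by simp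
    also have "cis (2 * pi * d) = 1"
      unfolding d_def by (intro cis_multiple_2pi) simp
    finally show ?thesis .
  qed
  moreover have "\<omega> \<noteq> 1"
  proof
    assume "\<omega> = 1"
    then have "cos (2 * pi * d / N) = 1" by (simp add: \<omega>_def complex_eq_iff)
    then obtain n :: int where "2 * pi * d / N = of_int n * 2 * pi"
      unfolding cos_one_2pi_int by auto
    then have "d = of_int n * N" using N by (simp add: field_simps)
    then have "real_of_int (int l - int m) = real_of_int (n * int N)"
      by (simp add: d_def)
    then have "int l - int m = n * int N" by linarith
    moreover have "\<bar>int l - int m\<bar> < int N" "int l - int m \<noteq> 0" using assms by auto
    ultimately show False by (metis dvd_imp_le_int abs_of_nat dvd_triv_right not_less)
  qed
  ultimately have "(\<Sum>j<N. \<omega> ^ j) = 0"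
    by (simp add: geometric_sum)
  then show ?thesis
    by (simp only: term_eq sum_distrib_left[symmetric] mult_zero_right)
qed

text \<open>Expanding the squared norm and summing over the frequencies first leaves only the diagonal
  terms. The exponent \<open>Suc l\<close> instead of \<open>l\<close> changes the vectors by a unimodular factor only; it is the
  form in which the orbit sums arise below.\<close>

lemma finite_Parseval:
  fixes v :: "nat \<Rightarrow> 'a::complex_inner"
  shows "(\<Sum>j<N. (norm (\<Sum>l<N. antiperiodic_node N j ^ Suc l *\<^sub>C v l))\<^sup>2) = real N * (\<Sum>l<N. (norm (v l))\<^sup>2)"
proof -
  let ?\<mu> = "antiperiodic_node N"
  have norm_sq: "(norm (\<Sum>l<N. ?\<mu> j ^ Suc l *\<^sub>C v l))\<^sup>2
      = Re (\<Sum>l<N. \<Sum>m<N. ?\<mu> j ^ l * cnj (?\<mu> j ^ m) * cinner (v l) (v m))" for j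
  proof -
    have "(\<Sum>l<N. ?\<mu> j ^ Suc l *\<^sub>C v l) = ?\<mu> j *\<^sub>C (\<Sum>l<N. ?\<mu> j ^ l *\<^sub>C v l)"
      by (simp add: complex_vector.scale_sum_right scaleC_scaleC)
    then have "(norm (\<Sum>l<N. ?\<mu> j ^ Suc l *\<^sub>C v l))\<^sup>2 = (norm (\<Sum>l<N. ?\<mu> j ^ l *\<^sub>C v l))\<^sup>2"
      by (simp add: norm_scaleC norm_antiperiodic_node)
    also have "\<dots> = (\<Sum>l<N. \<Sum>m<N. inner (?\<mu> j ^ l *\<^sub>C v l) (?\<mu> j ^ m *\<^sub>C v m))"
      by (simp add: power2_norm_eq_inner inner_sum_left inner_sum_right inner_commute)
    finally show ?thesis
      by (simp only: Re_cinner[symmetric] cinner_scaleC_left cinner_scaleC_right Re_sum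
          complex_cnj_power mult_ac)
  qed
  have "(\<Sum>j<N. \<Sum>l<N. \<Sum>m<N. ?\<mu> j ^ l * cnj (?\<mu> j ^ m) * cinner (v l) (v m))
      = (\<Sum>l<N. \<Sum>m<N. (\<Sum>j<N. ?\<mu> j ^ l * cnj (?\<mu> j ^ m)) * cinner (v l) (v m))"
    unfolding sum_distrib_right
    by (subst sum.swap) (rule sum.cong[OF refl], rule sum.swap)
  also have "\<dots> = (\<Sum>l<N. \<Sum>m<N. if l = m then of_nat N * cinner (v l) (v m) else 0)"
  proof (intro sum.cong refl)
    fix l m assume lm: "l \<in> {..<N}" "m \<in> {..<N}"
    have "?\<mu> j ^ l * cnj (?\<mu> j ^ l) = 1" for j
      by (simp add: complex_norm_square[symmetric] norm_power norm_antiperiodic_node del: complex_cnj_power)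
    then show "(\<Sum>j<N. ?\<mu> j ^ l * cnj (?\<mu> j ^ m)) * cinner (v l) (v m) =
        (if l = m then of_nat N * cinner (v l) (v m) else 0)"
      using sum_antiperiodic_node[of l N m] lm by auto
  qed
  also have "\<dots> = of_nat N * (\<Sum>l<N. cinner (v l) (v l))"
    by (simp add: sum_distrib_left)
  finally have "(\<Sum>j<N. \<Sum>l<N. \<Sum>m<N. ?\<mu> j ^ l * cnj (?\<mu> j ^ m) * cinner (v l) (v m))
    = of_nat N * (\<Sum>l<N. cinner (v l) (v l))" .
  then have "Re (\<Sum>j<N. \<Sum>l<N. \<Sum>m<N. ?\<mu> j ^ l * cnj (?\<mu> j ^ m) * cinner (v l) (v m))
    = real N * (\<Sum>l<N. Re (cinner (v l) (v l)))"
    by (simp add: Re_sum)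
  then show ?thesis
    unfolding norm_sq by (simp only: Re_sum Re_cinner power2_norm_eq_inner)
qed

section \<open>Power-bounded operators\<close>

text \<open>On a nontrivial space the bound with \<open>n = 0\<close> forces \<open>1 \<le> K\<close>; stating it separately covers the trivial
  space as well.\<close>

locale power_bounded =
  fixes T :: "'a::complex_hilbert_space \<Rightarrow> 'a" and K :: real
  assumes T_clinear: "bounded_clinear T"
    and K_ge_1: "1 \<le> K"
    and power_bound: "norm ((T ^^ n) x) \<le> K * norm x"
begin

definition A :: "'a \<Rightarrow> 'a"
  where "A x = x - T x"

lemma T_pow_clinear: "bounded_clinear (T ^^ n)"
  by (rule bounded_clinear_funpow[OF T_clinear])

lemma A_clinear: "bounded_clinear A"
  unfolding A_def using bounded_clinear_minus[OF bounded_clinear_id T_clinear] .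

lemma A_pow_clinear: "bounded_clinear (A ^^ k)"
  by (rule bounded_clinear_funpow[OF A_clinear])

lemma T_pow_A: "(T ^^ n) (A x) = A ((T ^^ n) x)"
  unfolding A_def bounded_clinear_diff[OF T_pow_clinear] by (simp add: funpow_swap1)

lemma T_pow_A_pow: "(T ^^ n) ((A ^^ k) x) = (A ^^ k) ((T ^^ n) x)"
  by (induction k) (simp_all add: T_pow_A)

lemma T_pow_add: "(T ^^ (m + n)) x = (T ^^ m) ((T ^^ n) x)"
  by (simp add: funpow_add)

text \<open>Distributing \<open>hk\<close> powers of \<open>T\<close> evenly over the \<open>k\<close> factors \<open>A\<close> lets a decay rate for
  \<open>T\<^sup>h A\<close> act \<open>k\<close> times.\<close>

lemma T_pow_A_pow_mult: "(T ^^ (h * k)) ((A ^^ k) x) = (((T ^^ h) \<circ> A) ^^ k) x"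
proof (induction k)
  case (Suc k)
  have "(T ^^ (h * Suc k)) ((A ^^ Suc k) x) = (T ^^ h) ((T ^^ (h * k)) (A ((A ^^ k) x)))"
    by (simp add: T_pow_add)
  also have "\<dots> = (T ^^ h) (A ((T ^^ (h * k)) ((A ^^ k) x)))"
    by (simp only: T_pow_A)
  finally show ?case by (simp add: Suc)
qed simp

lemma norm_A_le: "norm (A x) \<le> (1 + K) * norm x"
  using norm_triangle_ineq4[of x "T x"] power_bound[of 1 x] by (simp add: A_def algebra_simps)

lemma norm_T_pow_mono:
  assumes "m \<le> n"
  shows "norm ((T ^^ n) x) \<le> K * norm ((T ^^ m) x)"
  using power_bound[of "n - m" "(T ^^ m) x"] assms by (simp add: T_pow_add[symmetric])

text \<open>The hypothesis says \<open>\<parallel>R(\<mu>,T) B\<parallel> \<le> M\<close> on the circle, without mentioning an inverse. Weight the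
  first \<open>4n\<close> terms of the orbit of \<open>x\<close> by a tent function \<open>w\<close> of slope \<open>\<plusminus>1\<close> that vanishes at both ends.
  Summation by parts turns \<open>(\<mu> - T) \<Sum> w\<^sub>l \<mu>\<^bsup>-l-1\<^esup> T\<^sup>l x\<close> into an orbit sum whose coefficients \<open>\<plusminus>1\<close> are the
  slopes, with no boundary terms. By Parseval's identity the square sum of \<open>w\<^sub>l T\<^sup>l B x\<close>, which is at least of order
  \<open>n\<^sup>3 \<parallel>T\<^bsup>4n\<^esup> B x\<parallel>\<^sup>2\<close>, is then at most of order \<open>M\<^sup>2 n \<parallel>x\<parallel>\<^sup>2\<close>.\<close>

lemma decay_of_multiplier:
  assumes B: "bounded_clinear B" and comm: "\<And>x. B (T x) = T (B x)"
    and M: "\<And>\<mu> e f. cmod \<mu> = 1 \<Longrightarrow> \<mu> \<noteq> 1 \<Longrightarrow> \<mu> *\<^sub>C e - T e = B f \<Longrightarrow> norm e \<le> M * norm f"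
    and "M \<ge> 0" and n: "n > 0"
  shows "norm ((T ^^ (4 * n)) (B x)) \<le> 2 * K\<^sup>2 * M / real n * norm x"
proof -
  define N where "N = 4 * n"
  define w where "w l = real (min l (N - l))" for l
  define d where "d l = w (Suc l) - w l" for l
  have N: "N > 0" using n by (simp add: N_def)
  have w_ends: "w 0 = 0" "w N = 0" by (simp_all add: w_def)
  have d: "\<bar>d l\<bar> \<le> 1" for l
    unfolding d_def w_def by (cases "l < N") (auto simp: min_def)
  let ?\<nu> = "antiperiodic_node N"
  define E where "E j = (\<Sum>l<N. ?\<nu> j ^ Suc l *\<^sub>C (w l *\<^sub>R (T ^^ l) x))" for j
  define F where "F j = (\<Sum>l<N. ?\<nu> j ^ Suc l *\<^sub>C (d l *\<^sub>R (T ^^ Suc l) x))" for j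
  \<comment> \<open>The nodes are written \<open>\<nu> = 1/\<mu> = cnj \<mu>\<close>, so that the weights are positive powers.\<close>
  have resolvent_eq: "cnj (?\<nu> j) *\<^sub>C E j - T (E j) = F j" for j
  proof -
    define g where "g l = ?\<nu> j ^ l *\<^sub>C (w l *\<^sub>R (T ^^ l) x)" for l
    have unit: "cnj (?\<nu> j) * ?\<nu> j = 1"
      unfolding mult.commute[of "cnj (?\<nu> j)"]
      by (simp add: complex_norm_square[symmetric] norm_antiperiodic_node)
    then have cancel: "cnj (?\<nu> j) * (?\<nu> j * z) = z" for z
      by (simp add: mult.assoc[symmetric])
    have "cnj (?\<nu> j) *\<^sub>C E j = (\<Sum>l<N. g l)"
      unfolding E_def g_def complex_vector.scale_sum_right by (simp add: scaleC_scaleC cancel)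
    also have "(\<Sum>l<N. g l) = (\<Sum>l<N. g (Suc l))"
      using sum_lessThan_telescope[of g N] by (simp add: sum_subtractf g_def w_ends)
    finally have "cnj (?\<nu> j) *\<^sub>C E j = (\<Sum>l<N. g (Suc l))" .
    moreover have "T (E j) = (\<Sum>l<N. ?\<nu> j ^ Suc l *\<^sub>C (w l *\<^sub>R (T ^^ Suc l) x))"
      unfolding E_def
      by (simp add: bounded_clinear_sum[OF T_clinear] bounded_clinear_scaleC[OF T_clinear]
          bounded_clinear_scaleR[OF T_clinear])
    ultimately show ?thesis
      unfolding F_def d_def g_def
      by (simp add: sum_subtractf[symmetric] complex_vector.scale_right_diff_distrib scaleR_diff_left)
  qed
  have B_pow: "B ((T ^^ l) y) = (T ^^ l) (B y)" for l y
    by (induction l) (simp_all add: comm)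
  have BE: "B (E j) = (\<Sum>l<N. ?\<nu> j ^ Suc l *\<^sub>C (w l *\<^sub>R (T ^^ l) (B x)))" for j
    unfolding E_def
    by (simp add: bounded_clinear_sum[OF B] bounded_clinear_scaleC[OF B]
        bounded_clinear_scaleR[OF B] B_pow)
  have norm_BE: "norm (B (E j)) \<le> M * norm (F j)" for j
  proof (rule M[of "cnj (?\<nu> j)"])
    show "cmod (cnj (?\<nu> j)) = 1" by (simp add: norm_antiperiodic_node)
    show "cnj (?\<nu> j) \<noteq> 1" using antiperiodic_node_neq_1[OF N, of j] by simp
    show "cnj (?\<nu> j) *\<^sub>C B (E j) - T (B (E j)) = B (F j)"
      by (simp add: resolvent_eq[symmetric] bounded_clinear_diff[OF B] bounded_clinear_scaleC[OF B] comm)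
  qed
  define S where "S = (\<Sum>l<N. (norm (w l *\<^sub>R (T ^^ l) (B x)))\<^sup>2)"
  have "real N * S = (\<Sum>j<N. (norm (B (E j)))\<^sup>2)"
    unfolding BE S_def by (rule finite_Parseval[symmetric])
  also have "\<dots> \<le> (\<Sum>j<N. M\<^sup>2 * (norm (F j))\<^sup>2)"
    unfolding power_mult_distrib[symmetric] by (intro sum_mono power_mono norm_BE) auto
  also have "\<dots> = M\<^sup>2 * (real N * (\<Sum>l<N. (norm (d l *\<^sub>R (T ^^ Suc l) x))\<^sup>2))"
    unfolding F_def sum_distrib_left[symmetric] finite_Parseval ..
  also have "\<dots> \<le> M\<^sup>2 * (real N * (\<Sum>l<N. (K * norm x)\<^sup>2))"
  proof (intro mult_left_mono sum_mono power_mono)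
    fix l
    have "\<bar>d l\<bar> * norm ((T ^^ Suc l) x) \<le> 1 * (K * norm x)"
      by (intro mult_mono d power_bound) auto
    then show "norm (d l *\<^sub>R (T ^^ Suc l) x) \<le> K * norm x" by simp
  qed auto
  also have "\<dots> = real N * (M\<^sup>2 * (real N * (K * norm x)\<^sup>2))"
    by simp
  finally have upper: "S \<le> M\<^sup>2 * (real N * (K * norm x)\<^sup>2)"
    using N by (simp only: mult_le_cancel_left_pos of_nat_0_less_iff)
  define y where "y = norm ((T ^^ N) (B x))"
  \<comment> \<open>On the middle half \<open>n \<le> l < 3n\<close> of the tent the weights are at least \<open>n\<close>.\<close>
  have "(2 * real n) * (real n * y)\<^sup>2 = (\<Sum>l\<in>{n..<3*n}. (real n * y)\<^sup>2)"
    by simp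
  also have "\<dots> \<le> (\<Sum>l\<in>{n..<3*n}. (K * norm (w l *\<^sub>R (T ^^ l) (B x)))\<^sup>2)"
  proof (intro sum_mono power_mono)
    fix l assume l: "l \<in> {n..<3*n}"
    have "real n \<le> w l" using l by (auto simp: w_def N_def)
    moreover have "y \<le> K * norm ((T ^^ l) (B x))"
      unfolding y_def by (rule norm_T_pow_mono) (use l in \<open>simp add: N_def\<close>)
    ultimately have "real n * y \<le> w l * (K * norm ((T ^^ l) (B x)))"
      by (intro mult_mono) (auto simp: w_def y_def)
    then show "real n * y \<le> K * norm (w l *\<^sub>R (T ^^ l) (B x))"
      by (simp add: w_def mult_ac)
  qed (auto simp: y_def)
  also have "\<dots> \<le> (\<Sum>l<N. (K * norm (w l *\<^sub>R (T ^^ l) (B x)))\<^sup>2)"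
    by (rule sum_mono2) (auto simp: N_def)
  also have "\<dots> = K\<^sup>2 * S"
    unfolding S_def power_mult_distrib sum_distrib_left ..
  also have "\<dots> \<le> K\<^sup>2 * (M\<^sup>2 * (real N * (K * norm x)\<^sup>2))"
    by (rule mult_left_mono[OF upper]) simp
  finally have "(2 * real n) * (real n * y)\<^sup>2 \<le> (2 * real n) * (2 * (K\<^sup>2 * M * norm x)\<^sup>2)"
    by (simp add: N_def power_mult_distrib power2_eq_square mult_ac)
  then have "(real n * y)\<^sup>2 \<le> 2 * (K\<^sup>2 * M * norm x)\<^sup>2"
    using n by simp
  also have "\<dots> \<le> (2 * (K\<^sup>2 * M * norm x))\<^sup>2"
    by (simp add: power_mult_distrib)
  finally have "real n * y \<le> 2 * (K\<^sup>2 * M * norm x)"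
    by (rule power2_le_imp_le) (use \<open>M \<ge> 0\<close> in simp)
  then show ?thesis
    using n by (simp add: y_def N_def field_simps)
qed

definition cesaro :: "nat \<Rightarrow> 'a \<Rightarrow> 'a"
  where "cesaro m x = (1 / real m) *\<^sub>R (\<Sum>k<m. (T ^^ k) x)"

text \<open>Formally \<open>(I - C\<^sub>m) (I - T)\<^sup>-\<^sup>1\<close>, written as the polynomial in \<open>T\<close> that it is; see
  \<open>A_cesaro_quot\<close>. Its norm grows like \<open>m\<close>.\<close>

definition cesaro_quot :: "nat \<Rightarrow> 'a \<Rightarrow> 'a"
  where "cesaro_quot m x = (1 / real m) *\<^sub>R (\<Sum>k<m. \<Sum>j<k. (T ^^ j) x)"

text \<open>A filter that is uniformly bounded in \<open>m\<close>, close to the identity at frequencies far from \<open>1\<close>, and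
  divisible by \<open>A\<close>.\<close>

definition co_cesaro :: "nat \<Rightarrow> 'a \<Rightarrow> 'a"
  where "co_cesaro m x = x - cesaro m x"

lemma cesaro_clinear: "bounded_clinear (cesaro m)"
  unfolding cesaro_def by (intro bounded_clinear_fun_scaleR bounded_clinear_fun_sum T_pow_clinear)

lemma co_cesaro_clinear: "bounded_clinear (co_cesaro m)"
  unfolding co_cesaro_def by (intro bounded_clinear_minus bounded_clinear_id cesaro_clinear)

lemma A_sum_T_pow: "A (\<Sum>j<k. (T ^^ j) x) = x - (T ^^ k) x"
proof -
  have "A (\<Sum>j<k. (T ^^ j) x) = (\<Sum>j<k. (T ^^ j) x - (T ^^ Suc j) x)"
    unfolding bounded_clinear_sum[OF A_clinear] by (simp add: A_def)
  also have "\<dots> = (T ^^ 0) x - (T ^^ k) x"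
    by (rule sum_lessThan_telescope')
  finally show ?thesis by simp
qed

lemma A_cesaro_quot: "m > 0 \<Longrightarrow> A (cesaro_quot m x) = co_cesaro m x"
  unfolding cesaro_quot_def co_cesaro_def cesaro_def bounded_clinear_scaleR[OF A_clinear]
    bounded_clinear_sum[OF A_clinear, of _ "{..<m}"] A_sum_T_pow
  by (simp add: sum_subtractf scaleR_diff_right sum_constant_scaleR)

lemma A_co_cesaro: "A (co_cesaro m x) = co_cesaro m (A x)"
  by (simp add: co_cesaro_def cesaro_def bounded_clinear_diff[OF A_clinear]
      bounded_clinear_scaleR[OF A_clinear] bounded_clinear_sum[OF A_clinear] T_pow_A)

lemma A_co_cesaro_pow: "A ((co_cesaro m ^^ i) x) = (co_cesaro m ^^ i) (A x)"
  by (induction i arbitrary: x) (simp_all add: A_co_cesaro)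

lemma norm_sum_T_pow: "norm (\<Sum>j<k. (T ^^ j) x) \<le> real k * K * norm x"
  using sum_norm_bound[of "{..<k}" "\<lambda>j. (T ^^ j) x" "K * norm x"] power_bound by simp

lemma norm_cesaro_le: "norm (cesaro m x) \<le> K * norm x"
proof (cases "m = 0")
  case True
  then show ?thesis using K_ge_1 by (simp add: cesaro_def)
next
  case False
  then show ?thesis using norm_sum_T_pow[of x m] by (simp add: cesaro_def field_simps)
qed

lemma norm_cesaro_quot_le: "norm (cesaro_quot m x) \<le> K * real m * norm x"
proof -
  have "norm (\<Sum>k<m. \<Sum>j<k. (T ^^ j) x) \<le> (\<Sum>k<m. real m * K * norm x)"
  proof (rule sum_norm_le)
    fix k assume "k \<in> {..<m}"
    then have "real k * (K * norm x) \<le> real m * (K * norm x)"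
      using K_ge_1 by (intro mult_right_mono) auto
    then show "norm (\<Sum>j<k. (T ^^ j) x) \<le> real m * K * norm x"
      using norm_sum_T_pow[of x k] by simp
  qed
  then show ?thesis
    by (cases "m = 0") (simp_all add: cesaro_quot_def field_simps)
qed

lemma norm_co_cesaro_le: "norm (co_cesaro m x) \<le> (1 + K) * norm x"
  using norm_triangle_ineq4[of x "cesaro m x"] norm_cesaro_le[of m x]
  by (simp add: co_cesaro_def algebra_simps)

lemma norm_co_cesaro_pow_le: "norm ((co_cesaro m ^^ i) x) \<le> (1 + K) ^ i * norm x"
proof (induction i)
  case (Suc i)
  have "norm ((co_cesaro m ^^ Suc i) x) \<le> (1 + K) * norm ((co_cesaro m ^^ i) x)"
    using norm_co_cesaro_le by simp
  also have "\<dots> \<le> (1 + K) * ((1 + K) ^ i * norm x)"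
    using K_ge_1 Suc by (intro mult_left_mono) auto
  finally show ?case by simp
qed simp

text \<open>\<open>A C\<^sub>m = (I - T\<^sup>m) / m\<close> by telescoping.\<close>

lemma norm_A_cesaro_le: "norm (A (cesaro m x)) \<le> (1 + K) / real m * norm x"
proof -
  have "norm (x - (T ^^ m) x) \<le> (1 + K) * norm x"
    using norm_triangle_ineq4[of x "(T ^^ m) x"] power_bound[of m x] by (simp add: algebra_simps)
  then show ?thesis
    by (simp add: cesaro_def bounded_clinear_scaleR[OF A_clinear] A_sum_T_pow divide_right_mono)
qed

text \<open>The part of \<open>A\<close> that the filter discards is small, because \<open>I - (I - C\<^sub>m)\<^sup>i\<close> contains a
  factor \<open>C\<^sub>m\<close> and \<open>A C\<^sub>m\<close> has norm \<open>O(1/m)\<close>.\<close>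

lemma norm_A_minus_A_co_cesaro_pow:
  "norm (A x - A ((co_cesaro m ^^ i) x)) \<le> real i * (1 + K) ^ Suc i / real m * norm x"
proof (induction i)
  case (Suc i)
  let ?y = "(co_cesaro m ^^ i) x"
  have "A x - A ((co_cesaro m ^^ Suc i) x) = (A x - A ?y) + A (cesaro m ?y)"
    by (simp add: co_cesaro_def bounded_clinear_diff[OF A_clinear])
  then have "norm (A x - A ((co_cesaro m ^^ Suc i) x)) \<le> norm (A x - A ?y) + norm (A (cesaro m ?y))"
    by (metis norm_triangle_ineq)
  also have "\<dots> \<le> real i * (1 + K) ^ Suc i / real m * norm x + (1 + K) / real m * ((1 + K) ^ i * norm x)"
  proof (rule add_mono[OF Suc])
    have "(1 + K) / real m * norm ?y \<le> (1 + K) / real m * ((1 + K) ^ i * norm x)"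
      using K_ge_1 by (intro mult_left_mono norm_co_cesaro_pow_le) auto
    then show "norm (A (cesaro m ?y)) \<le> (1 + K) / real m * ((1 + K) ^ i * norm x)"
      using norm_A_cesaro_le[of m ?y] by linarith
  qed
  also have "\<dots> = real (Suc i) * (1 + K) ^ Suc i / real m * norm x"
    by (simp add: algebra_simps add_divide_distrib)
  also have "\<dots> \<le> real (Suc i) * (1 + K) ^ Suc (Suc i) / real m * norm x"
    using K_ge_1 by (intro mult_right_mono divide_right_mono mult_left_mono power_increasing) auto
  finally show ?case .
qed simp

end

section \<open>The rate in the Katznelson--Tzafriri theorem\<close>

text \<open>A bound on the resolvent along the circle enters only through this lower bound for \<open>\<mu> - T\<close>,
  with \<open>\<bar>\<mu> - 1\<bar>\<close> in place of the angle.\<close>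

locale resolvent_growth = power_bounded +
  fixes \<alpha> C :: real
  assumes \<alpha>_ge_1: "1 \<le> \<alpha>" and C_nonneg: "0 \<le> C"
    and resolvent_bound: "cmod \<mu> = 1 \<Longrightarrow> \<mu> \<noteq> 1 \<Longrightarrow>
      norm x \<le> C * cmod (\<mu> - 1) powr (- \<alpha>) * norm (\<mu> *\<^sub>C x - T x)"
begin

text \<open>Since \<open>A = (\<mu> - T) + (1 - \<mu>)\<close>, subtracting \<open>h\<close> from a solution of \<open>(\<mu> - T) e = A h\<close> trades the
  factor \<open>A\<close> on the right for the small factor \<open>1 - \<mu>\<close>.\<close>

lemma shift_solution:
  assumes "\<mu> *\<^sub>C e - T e = A h"
  shows "\<mu> *\<^sub>C (e - h) - T (e - h) = (1 - \<mu>) *\<^sub>C h"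
  using assms
  by (simp add: A_def bounded_clinear_diff[OF T_clinear] complex_vector.scale_right_diff_distrib
      complex_vector.scale_left_diff_distrib scaleC_one algebra_simps)

text \<open>This estimates \<open>R(\<mu>,T) (I - C\<^sub>m)\<^sup>i\<close> for \<open>\<rho> = \<bar>\<mu> - 1\<bar> \<le> 1/m\<close>. Each factor
  \<open>I - C\<^sub>m = A D\<close>, with \<open>D = cesaro_quot m\<close> and \<open>\<parallel>D\<parallel> \<le> K m\<close>, is traded by \<open>shift_solution\<close> for \<open>(1 - \<mu>) D\<close>, of
  norm at most \<open>K \<rho> m\<close>; the vectors subtracted on the way have norm \<open>O(m)\<close>. What remains after \<open>i\<close> steps is the bare
  resolvent, of size \<open>\<rho>\<^bsup>-\<alpha>\<^esup>\<close>.\<close>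

lemma co_cesaro_pow_solution_bound:
  "\<exists>c\<ge>0. \<forall>m>0. \<forall>\<mu> e f. cmod \<mu> = 1 \<longrightarrow> \<mu> \<noteq> 1 \<longrightarrow> cmod (\<mu> - 1) * real m \<le> 1 \<longrightarrow>
     \<mu> *\<^sub>C e - T e = (co_cesaro m ^^ i) f \<longrightarrow>
     norm e \<le> (c * real m + K ^ i * (cmod (\<mu> - 1) * real m) ^ i * C * cmod (\<mu> - 1) powr (- \<alpha>)) * norm f"
proof (induction i)
  case 0
  then show ?case
    using resolvent_bound by (intro exI[of _ 0]) fastforce
next
  case (Suc i)
  then obtain c where c: "c \<ge> 0" and IH: "\<And>m \<mu> e f. m > 0 \<Longrightarrow> cmod \<mu> = 1 \<Longrightarrow> \<mu> \<noteq> 1 \<Longrightarrow>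
      cmod (\<mu> - 1) * real m \<le> 1 \<Longrightarrow> \<mu> *\<^sub>C e - T e = (co_cesaro m ^^ i) f \<Longrightarrow>
     norm e \<le> (c * real m + K ^ i * (cmod (\<mu> - 1) * real m) ^ i * C * cmod (\<mu> - 1) powr (- \<alpha>)) * norm f"
    by (elim exE conjE) (rule that, assumption, simp)
  show ?case
  proof (intro exI[of _ "K * (1 + K) ^ i + c * K"] conjI allI impI)
    show "0 \<le> K * (1 + K) ^ i + c * K" using c K_ge_1 by simp
    fix m :: nat and \<mu> e f
    assume m: "m > 0" and \<mu>: "cmod \<mu> = 1" "\<mu> \<noteq> 1" and small: "cmod (\<mu> - 1) * real m \<le> 1"
      and eq: "\<mu> *\<^sub>C e - T e = (co_cesaro m ^^ Suc i) f"
    define \<rho> where "\<rho> = cmod (\<mu> - 1)"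
    define h where "h = (co_cesaro m ^^ i) (cesaro_quot m f)"
    have "(co_cesaro m ^^ Suc i) f = (co_cesaro m ^^ i) (A (cesaro_quot m f))"
      by (simp only: A_cesaro_quot[OF m] funpow_swap1 funpow.simps comp_def)
    also have "\<dots> = A h" unfolding h_def A_co_cesaro_pow ..
    finally have "\<mu> *\<^sub>C (e - h) - T (e - h) = (1 - \<mu>) *\<^sub>C h"
      using eq by (intro shift_solution) simp
    also have "\<dots> = (co_cesaro m ^^ i) ((1 - \<mu>) *\<^sub>C cesaro_quot m f)"
      unfolding h_def by (rule bounded_clinear_scaleC[OF bounded_clinear_funpow[OF co_cesaro_clinear], symmetric])
    finally have e_h: "norm (e - h) \<le> (c * real m + K ^ i * (\<rho> * real m) ^ i * C * \<rho> powr (- \<alpha>))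
        * norm ((1 - \<mu>) *\<^sub>C cesaro_quot m f)"
      unfolding \<rho>_def by (rule IH[OF m \<mu> small])
    have quot: "norm ((1 - \<mu>) *\<^sub>C cesaro_quot m f) \<le> (\<rho> * real m) * K * norm f"
      using mult_left_mono[OF norm_cesaro_quot_le[of m f], of \<rho>]
      by (simp add: norm_scaleC \<rho>_def norm_minus_commute mult_ac)
    have h: "norm h \<le> K * (1 + K) ^ i * real m * norm f"
    proof -
      have "norm h \<le> (1 + K) ^ i * norm (cesaro_quot m f)"
        unfolding h_def by (rule norm_co_cesaro_pow_le)
      also have "\<dots> \<le> (1 + K) ^ i * (K * real m * norm f)"
        using K_ge_1 by (intro mult_left_mono norm_cesaro_quot_le) simp
      finally show ?thesis by (simp add: mult_ac)
    qed
    have "norm e \<le> norm h + norm (e - h)"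
      using norm_triangle_ineq[of h "e - h"] by simp
    also have "\<dots> \<le> K * (1 + K) ^ i * real m * norm f
      + (c * real m + K ^ i * (\<rho> * real m) ^ i * C * \<rho> powr (- \<alpha>)) * ((\<rho> * real m) * K * norm f)"
      using K_ge_1 c C_nonneg
      by (intro add_mono h order_trans[OF e_h] mult_left_mono quot) (auto simp: \<rho>_def)
    also have "\<dots> = (K * (1 + K) ^ i * real m + (\<rho> * real m) * (c * K * real m)
      + K ^ Suc i * (\<rho> * real m) ^ Suc i * C * \<rho> powr (- \<alpha>)) * norm f"
      by (simp add: algebra_simps)
    also have "\<dots> \<le> (K * (1 + K) ^ i * real m + 1 * (c * K * real m)
      + K ^ Suc i * (\<rho> * real m) ^ Suc i * C * \<rho> powr (- \<alpha>)) * norm f"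
      using small K_ge_1 c C_nonneg by (intro mult_right_mono add_mono) (auto simp: \<rho>_def)
    finally show "norm e \<le> ((K * (1 + K) ^ i + c * K) * real m
       + K ^ Suc i * (cmod (\<mu> - 1) * real m) ^ Suc i * C * cmod (\<mu> - 1) powr (- \<alpha>)) * norm f"
      by (simp add: \<rho>_def algebra_simps)
  qed
qed

text \<open>One more factor \<open>A\<close> is traded for \<open>1 - \<mu>\<close>. For \<open>\<rho> = \<bar>\<mu> - 1\<bar> \<ge> 1/m\<close> the bare resolvent bound gives
  \<open>\<rho>\<^bsup>1-\<alpha>\<^esup> \<le> m\<^bsup>\<alpha>-1\<^esup>\<close>. For \<open>\<rho> < 1/m\<close> the preceding lemma gives \<open>(\<rho> m)\<^sup>q \<rho>\<^bsup>1-\<alpha>\<^esup>\<close>, and \<open>q \<ge> \<alpha> - 1\<close> is exactly what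
  makes this at most \<open>m\<^bsup>\<alpha>-1\<^esup>\<close>.\<close>

lemma multiplier_bound:
  assumes q: "\<alpha> - 1 \<le> real q"
  shows "\<exists>M\<ge>0. \<forall>m>0. \<forall>\<mu> e f. cmod \<mu> = 1 \<longrightarrow> \<mu> \<noteq> 1 \<longrightarrow>
     \<mu> *\<^sub>C e - T e = A ((co_cesaro m ^^ q) f) \<longrightarrow> norm e \<le> M * real m powr (\<alpha> - 1) * norm f"
proof -
  obtain c where c: "c \<ge> 0" and near: "\<And>m \<mu> e f. m > 0 \<Longrightarrow> cmod \<mu> = 1 \<Longrightarrow> \<mu> \<noteq> 1 \<Longrightarrow>
      cmod (\<mu> - 1) * real m \<le> 1 \<Longrightarrow> \<mu> *\<^sub>C e - T e = (co_cesaro m ^^ q) f \<Longrightarrow>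
     norm e \<le> (c * real m + K ^ q * (cmod (\<mu> - 1) * real m) ^ q * C * cmod (\<mu> - 1) powr (- \<alpha>)) * norm f"
    using co_cesaro_pow_solution_bound[of q] by (elim exE conjE) (rule that, assumption, simp)
  define M where "M = (1 + C) * (1 + K) ^ q + c + K ^ q * C"
  show ?thesis
  proof (intro exI[of _ M] conjI allI impI)
    show "M \<ge> 0" using c C_nonneg K_ge_1 by (simp add: M_def)
    fix m :: nat and \<mu> e f
    assume m: "m > 0" and \<mu>: "cmod \<mu> = 1" "\<mu> \<noteq> 1"
      and eq: "\<mu> *\<^sub>C e - T e = A ((co_cesaro m ^^ q) f)"
    define \<rho> where "\<rho> = cmod (\<mu> - 1)"
    have \<rho>: "\<rho> > 0" using \<mu> by (simp add: \<rho>_def)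
    define h where "h = (co_cesaro m ^^ q) f"
    have h: "norm h \<le> (1 + K) ^ q * norm f"
      unfolding h_def by (rule norm_co_cesaro_pow_le)
    have m1: "1 \<le> real m powr (\<alpha> - 1)"
      using m \<alpha>_ge_1 by (intro ge_one_powr_ge_zero) auto
    have \<rho>_powr: "\<rho> * \<rho> powr (- \<alpha>) = \<rho> powr (1 - \<alpha>)"
      using \<rho> powr_add[of \<rho> 1 "- \<alpha>"] by simp
    have shifted: "\<mu> *\<^sub>C (e - h) - T (e - h) = (1 - \<mu>) *\<^sub>C h"
      using eq by (intro shift_solution) (simp add: h_def)
    have "norm (e - h) \<le> (C * (1 + K) ^ q + c + K ^ q * C) * real m powr (\<alpha> - 1) * norm f"
    proof (cases "\<rho> * real m \<le> 1")
      case True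
      have "\<mu> *\<^sub>C (e - h) - T (e - h) = (co_cesaro m ^^ q) ((1 - \<mu>) *\<^sub>C f)"
        unfolding bounded_clinear_scaleC[OF bounded_clinear_funpow[OF co_cesaro_clinear]]
        using shifted by (simp only: h_def)
      from near[OF m \<mu> True[unfolded \<rho>_def] this]
      have "norm (e - h) \<le> (c * real m + K ^ q * (\<rho> * real m) ^ q * C * \<rho> powr (- \<alpha>)) * (\<rho> * norm f)"
        by (simp add: \<rho>_def norm_scaleC norm_minus_commute)
      also have "\<dots> = (c * (\<rho> * real m) + K ^ q * C * ((\<rho> * real m) ^ q * \<rho> powr (1 - \<alpha>))) * norm f"
        unfolding \<rho>_powr[symmetric] by (simp add: algebra_simps)
      also have "\<dots> \<le> (c * real m powr (\<alpha> - 1) + K ^ q * C * real m powr (\<alpha> - 1)) * norm f"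
      proof (intro mult_right_mono add_mono mult_left_mono)
        show "\<rho> * real m \<le> real m powr (\<alpha> - 1)" using True m1 by linarith
        have "(\<rho> * real m) ^ q = (\<rho> * real m) powr real q"
          using \<rho> m by (simp add: powr_realpow)
        also have "\<dots> \<le> (\<rho> * real m) powr (\<alpha> - 1)"
          using \<rho> m True q by (intro powr_mono') auto
        finally have "(\<rho> * real m) ^ q * \<rho> powr (1 - \<alpha>)
            \<le> (\<rho> * real m) powr (\<alpha> - 1) * \<rho> powr (1 - \<alpha>)"
          by (intro mult_right_mono) auto
        also have "\<dots> = real m powr (\<alpha> - 1) * (\<rho> powr (\<alpha> - 1) * \<rho> powr (1 - \<alpha>))"
          using \<rho> by (simp add: powr_mult mult_ac)
        also have "\<rho> powr (\<alpha> - 1) * \<rho> powr (1 - \<alpha>) = 1"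
          using \<rho> by (simp add: powr_add[symmetric])
        finally show "(\<rho> * real m) ^ q * \<rho> powr (1 - \<alpha>) \<le> real m powr (\<alpha> - 1)" by simp
      qed (use c C_nonneg K_ge_1 in auto)
      also have "\<dots> \<le> (C * (1 + K) ^ q + c + K ^ q * C) * real m powr (\<alpha> - 1) * norm f"
        using C_nonneg K_ge_1 by (simp add: algebra_simps)
      finally show ?thesis .
    next
      case False
      have "norm (e - h) \<le> C * \<rho> powr (- \<alpha>) * norm ((1 - \<mu>) *\<^sub>C h)"
        using resolvent_bound[OF \<mu>, of "e - h"] by (simp only: shifted \<rho>_def)
      also have "\<dots> = C * \<rho> powr (1 - \<alpha>) * norm h"
        unfolding \<rho>_powr[symmetric] by (simp add: norm_scaleC \<rho>_def norm_minus_commute)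
      also have "\<dots> \<le> C * real m powr (\<alpha> - 1) * ((1 + K) ^ q * norm f)"
      proof (intro mult_mono h)
        have "\<rho> powr (1 - \<alpha>) \<le> (1 / real m) powr (1 - \<alpha>)"
          using False \<rho> m \<alpha>_ge_1 by (intro powr_mono2') (auto simp: field_simps)
        also have "\<dots> = real m powr (\<alpha> - 1)"
          using m by (simp add: powr_divide powr_minus_divide[symmetric])
        finally show "\<rho> powr (1 - \<alpha>) \<le> real m powr (\<alpha> - 1)" .
      qed (use C_nonneg in auto)
      also have "\<dots> = (C * (1 + K) ^ q) * real m powr (\<alpha> - 1) * norm f"
        by (simp add: mult_ac)
      also have "\<dots> \<le> (C * (1 + K) ^ q + c + K ^ q * C) * real m powr (\<alpha> - 1) * norm f"
        using c C_nonneg K_ge_1 by (intro mult_right_mono) auto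
      finally show ?thesis .
    qed
    moreover have "norm h \<le> (1 + K) ^ q * real m powr (\<alpha> - 1) * norm f"
    proof -
      have "(1 + K) ^ q * norm f * 1 \<le> (1 + K) ^ q * norm f * real m powr (\<alpha> - 1)"
        using m1 K_ge_1 by (intro mult_left_mono) auto
      then show ?thesis using h by (simp add: mult_ac)
    qed
    moreover have "norm e \<le> norm h + norm (e - h)"
      using norm_triangle_ineq[of h "e - h"] by simp
    ultimately show "norm e \<le> M * real m powr (\<alpha> - 1) * norm f"
      by (simp add: M_def algebra_simps)
  qed
qed

text \<open>With \<open>B = A (I - C\<^sub>m)\<^sup>q\<close> the two lemmas above give \<open>\<parallel>T\<^bsup>4n\<^esup> B\<parallel> = O(m\<^bsup>\<alpha>-1\<^esup> / n)\<close> and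
  \<open>\<parallel>T\<^bsup>4n\<^esup> (A - B)\<parallel> = O(1/m)\<close>. Both are \<open>O(n\<^bsup>-1/\<alpha>\<^esup>)\<close> for \<open>m = \<lfloor>n\<^bsup>1/\<alpha>\<^esup>\<rfloor>\<close>.\<close>

theorem Katznelson_Tzafriri_rate:
  "\<exists>C\<^sub>0\<ge>0. \<forall>n>0. \<forall>x. norm ((T ^^ n) (A x)) \<le> C\<^sub>0 * real n powr (- 1 / \<alpha>) * norm x"
proof -
  define q where "q = nat \<lceil>\<alpha>\<rceil>"
  have "\<alpha> - 1 \<le> real q" unfolding q_def by linarith
  from multiplier_bound[OF this] obtain M where M: "M \<ge> 0"
    and multiplier: "\<And>m \<mu> e f. m > 0 \<Longrightarrow> cmod \<mu> = 1 \<Longrightarrow> \<mu> \<noteq> 1 \<Longrightarrow>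
     \<mu> *\<^sub>C e - T e = A ((co_cesaro m ^^ q) f) \<Longrightarrow> norm e \<le> M * real m powr (\<alpha> - 1) * norm f"
    by (elim exE conjE) (rule that, assumption, simp)
  define L where "L = 2 * K\<^sup>2 * M + K * (real q * (1 + K) ^ Suc q)"
  have L: "L \<ge> 0" using M K_ge_1 by (simp add: L_def)
  have mult4: "norm ((T ^^ (4 * n)) (A x)) \<le> 2 * L * real n powr (- 1 / \<alpha>) * norm x" if n: "n > 0" for n x
  proof -
    define y where "y = real n powr (1 / \<alpha>)"
    define m where "m = nat \<lfloor>y\<rfloor>"
    have y: "1 \<le> y" unfolding y_def using n \<alpha>_ge_1 by (intro ge_one_powr_ge_zero) auto
    have m: "m > 0" "real m \<le> y" using y unfolding m_def by linarith+
    have "y < real m + 1" using y unfolding m_def by linarith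
    then have m2: "y \<le> 2 * real m" using m by linarith
    have "real m powr \<alpha> \<le> y powr \<alpha>" using m \<alpha>_ge_1 by (intro powr_mono2) auto
    also have "\<dots> = real n" using n \<alpha>_ge_1 by (simp add: y_def powr_powr)
    finally have m_n: "real m powr \<alpha> \<le> real n" .
    let ?B = "\<lambda>x. A ((co_cesaro m ^^ q) x)"
    have "norm ((T ^^ (4 * n)) (?B x)) \<le> 2 * K\<^sup>2 * (M * real m powr (\<alpha> - 1)) / real n * norm x"
    proof (rule decay_of_multiplier[OF _ _ _ _ n])
      show "bounded_clinear ?B"
        by (rule bounded_clinear_compose[OF A_clinear bounded_clinear_funpow[OF co_cesaro_clinear]])
      show "?B (T x) = T (?B x)" for x
      proof -
        have "?B (x - A x) = ?B x - A (?B x)"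
          by (simp add: bounded_clinear_diff[OF bounded_clinear_funpow[OF co_cesaro_clinear]]
              bounded_clinear_diff[OF A_clinear] A_co_cesaro_pow)
        then show ?thesis by (simp add: A_def)
      qed
    qed (use multiplier[OF m(1)] M in \<open>auto simp: mult.assoc\<close>)
    also have "real m powr (\<alpha> - 1) = real m powr \<alpha> / real m"
      using m by (simp add: powr_diff)
    also have "2 * K\<^sup>2 * (M * (real m powr \<alpha> / real m)) / real n * norm x
        = (2 * K\<^sup>2 * M / real m * norm x) * (real m powr \<alpha> / real n)"
      by simp
    also have "\<dots> \<le> (2 * K\<^sup>2 * M / real m * norm x) * 1"
      using M m_n n by (intro mult_left_mono) auto
    finally have part1: "norm ((T ^^ (4 * n)) (?B x)) \<le> 2 * K\<^sup>2 * M / real m * norm x" by simp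
    have "norm ((T ^^ (4 * n)) (A x - ?B x)) \<le> K * norm (A x - ?B x)"
      by (rule power_bound)
    also have "\<dots> \<le> K * (real q * (1 + K) ^ Suc q / real m * norm x)"
      using K_ge_1 by (intro mult_left_mono norm_A_minus_A_co_cesaro_pow) auto
    finally have part2: "norm ((T ^^ (4 * n)) (A x - ?B x)) \<le> K * (real q * (1 + K) ^ Suc q / real m * norm x)" .
    have "(T ^^ (4 * n)) (A x) = (T ^^ (4 * n)) (?B x) + (T ^^ (4 * n)) (A x - ?B x)"
      by (simp add: bounded_clinear_diff[OF T_pow_clinear])
    then have "norm ((T ^^ (4 * n)) (A x)) \<le> L / real m * norm x"
      using norm_triangle_ineq[of "(T ^^ (4 * n)) (?B x)" "(T ^^ (4 * n)) (A x - ?B x)"] part1 part2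
      by (simp add: L_def algebra_simps add_divide_distrib)
    also have "\<dots> \<le> L * (2 / y) * norm x"
      using m m2 y L mult_left_mono[of "1 / real m" "2 / y" L]
      by (intro mult_right_mono) (auto simp: field_simps)
    also have "\<dots> = 2 * L * real n powr (- 1 / \<alpha>) * norm x"
      by (simp add: y_def powr_minus_divide)
    finally show ?thesis .
  qed
  have powr_le: "real b powr (- 1 / \<alpha>) \<le> 8 * real a powr (- 1 / \<alpha>)" if "0 < a" "a \<le> 8 * b" "0 < b" for a b :: nat
  proof -
    have "(8 * real b) powr (- 1 / \<alpha>) \<le> real a powr (- 1 / \<alpha>)"
      using that \<alpha>_ge_1 by (intro powr_mono2') auto
    moreover have "(8 * real b) powr (- 1 / \<alpha>) = 8 powr (- 1 / \<alpha>) * real b powr (- 1 / \<alpha>)"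
      by (simp add: powr_mult)
    moreover have "8 powr (- 1) \<le> (8::real) powr (- 1 / \<alpha>)"
      using \<alpha>_ge_1 by (intro powr_mono) auto
    then have "1 / 8 * real b powr (- 1 / \<alpha>) \<le> 8 powr (- 1 / \<alpha>) * real b powr (- 1 / \<alpha>)"
      by (intro mult_right_mono) (simp_all add: powr_minus_divide)
    ultimately show ?thesis by simp
  qed
  define C\<^sub>0 where "C\<^sub>0 = 16 * K * L + 8 * K * (1 + K)"
  have "norm ((T ^^ n) (A x)) \<le> C\<^sub>0 * real n powr (- 1 / \<alpha>) * norm x" if n: "n > 0" for n x
  proof (cases "n < 4")
    case True
    have "norm ((T ^^ n) (A x)) \<le> K * ((1 + K) * norm x)"
      using power_bound[of n "A x"] mult_left_mono[OF norm_A_le[of x], of K] K_ge_1 by linarith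
    also have "\<dots> = K * (1 + K) * 1 * norm x" by simp
    also have "\<dots> \<le> K * (1 + K) * (8 * real n powr (- 1 / \<alpha>)) * norm x"
      using powr_le[of n 1] True n K_ge_1 by (intro mult_right_mono mult_left_mono) auto
    also have "\<dots> \<le> C\<^sub>0 * real n powr (- 1 / \<alpha>) * norm x"
      using L K_ge_1 by (simp add: C\<^sub>0_def algebra_simps)
    finally show ?thesis .
  next
    case False
    define b where "b = n div 4"
    have b: "b > 0" "4 * b \<le> n" "n \<le> 8 * b" using False unfolding b_def by presburger+
    have "norm ((T ^^ n) (A x)) \<le> K * norm ((T ^^ (4 * b)) (A x))"
      by (rule norm_T_pow_mono[OF b(2)])
    also have "\<dots> \<le> K * (2 * L * real b powr (- 1 / \<alpha>) * norm x)"
      using K_ge_1 by (intro mult_left_mono mult4 b) auto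
    also have "\<dots> = 2 * K * L * real b powr (- 1 / \<alpha>) * norm x" by simp
    also have "\<dots> \<le> 2 * K * L * (8 * real n powr (- 1 / \<alpha>)) * norm x"
      using powr_le[OF n b(3,1)] K_ge_1 L by (intro mult_right_mono mult_left_mono) auto
    also have "\<dots> \<le> C\<^sub>0 * real n powr (- 1 / \<alpha>) * norm x"
      using L K_ge_1 by (simp add: C\<^sub>0_def algebra_simps)
    finally show ?thesis .
  qed
  moreover have "C\<^sub>0 \<ge> 0" using L K_ge_1 by (simp add: C\<^sub>0_def)
  ultimately show ?thesis by blast
qed

end

section \<open>The ergodic decomposition\<close>

text \<open>Select points of almost minimal norm. The infima of the norms increase to a limit, and the midpoint of
  two selected points still lies in the larger set, so its norm is not much smaller; the parallelogram law forces the
  points together. In a complete space this replaces weak compactness of bounded sets.\<close>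

lemma decreasing_convex_Cauchy_selection:
  fixes S :: "nat \<Rightarrow> 'a::real_inner set"
  assumes "\<And>n. convex (S n)" and dec: "decseq S" and bounded: "\<And>n. \<exists>x\<in>S n. norm x \<le> b"
  shows "\<exists>p. (\<forall>n. p n \<in> S n) \<and> Cauchy p"
proof -
  define d where "d n = Inf (norm ` S n)" for n
  have bdd: "bdd_below (norm ` S n)" for n by (rule bdd_belowI[of _ 0]) auto
  have ne: "norm ` S n \<noteq> {}" for n using bounded[of n] by auto
  have d_le: "d n \<le> norm x" if "x \<in> S n" for n x
    unfolding d_def using that by (intro cInf_lower bdd) auto
  have d_nonneg: "0 \<le> d n" for n
    unfolding d_def using ne by (intro cInf_greatest) auto
  have "incseq d"
  proof (rule incseq_SucI)
    fix n
    show "d n \<le> d (Suc n)"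
      unfolding d_def using ne bdd decseqD[OF dec, of n "Suc n"] by (intro cInf_superset_mono) auto
  qed
  moreover have "d n \<le> b" for n using bounded[of n] d_le[of _ n] by force
  ultimately obtain D where D: "d \<longlonglongrightarrow> D" and d_D: "\<And>n. d n \<le> D"
    by (metis incseq_convergent)
  have "\<exists>x\<in>S n. norm x < d n + 1 / real (Suc n)" for n
    using cInf_lessD[OF ne, of n "d n + 1 / real (Suc n)"] by (auto simp: d_def)
  then obtain p where p: "\<And>n. p n \<in> S n" and p_norm: "\<And>n. norm (p n) < d n + 1 / real (Suc n)"
    by metis
  have close: "(dist (p m) (p n))\<^sup>2 \<le> 4 * (D + 1 / real (Suc N))\<^sup>2 - 4 * (d N)\<^sup>2"
    if "N \<le> m" "N \<le> n" for m n N
  proof -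
    have mem: "p m \<in> S N" "p n \<in> S N"
      using decseqD[OF dec that(1)] decseqD[OF dec that(2)] p by auto
    then have "(1/2) *\<^sub>R p m + (1/2) *\<^sub>R p n \<in> S N"
      using assms(1)[of N] by (intro convexD) auto
    then have "d N \<le> norm ((1/2) *\<^sub>R (p m + p n))"
      using d_le by (simp add: scaleR_add_right)
    then have "2 * d N \<le> norm (p m + p n)" by simp
    then have mid: "4 * (d N)\<^sup>2 \<le> (norm (p m + p n))\<^sup>2"
      using power_mono[of "2 * d N" "norm (p m + p n)" 2] d_nonneg by (simp add: power_mult_distrib)
    have norm_le: "(norm (p j))\<^sup>2 \<le> (D + 1 / real (Suc N))\<^sup>2" if "N \<le> j" for j
    proof (rule power_mono)
      have "1 / real (Suc j) \<le> 1 / real (Suc N)" using that by (intro divide_left_mono) auto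
      then show "norm (p j) \<le> D + 1 / real (Suc N)" using p_norm[of j] d_D[of j] by linarith
    qed simp
    have "(dist (p m) (p n))\<^sup>2 = 2 * (norm (p m))\<^sup>2 + 2 * (norm (p n))\<^sup>2 - (norm (p m + p n))\<^sup>2"
      by (simp add: dist_norm power2_norm_eq_inner inner_add_left inner_add_right inner_diff_left
          inner_diff_right inner_commute)
    then show ?thesis using mid norm_le[OF that(1)] norm_le[OF that(2)] by linarith
  qed
  have "(\<lambda>N. 4 * (D + 1 / real (Suc N))\<^sup>2 - 4 * (d N)\<^sup>2) \<longlonglongrightarrow> 4 * (D + 0)\<^sup>2 - 4 * D\<^sup>2"
    using LIMSEQ_Suc[OF lim_1_over_n] by (intro tendsto_intros D) simp
  then have lim: "(\<lambda>N. 4 * (D + 1 / real (Suc N))\<^sup>2 - 4 * (d N)\<^sup>2) \<longlonglongrightarrow> 0" by simp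
  have "Cauchy p"
  proof (rule metric_CauchyI)
    fix e :: real assume e: "e > 0"
    then have "\<forall>\<^sub>F N in sequentially. 4 * (D + 1 / real (Suc N))\<^sup>2 - 4 * (d N)\<^sup>2 < e\<^sup>2"
      by (intro order_tendstoD[OF lim]) simp
    then obtain N where N: "4 * (D + 1 / real (Suc N))\<^sup>2 - 4 * (d N)\<^sup>2 < e\<^sup>2"
      by (auto simp: eventually_sequentially)
    have "dist (p m) (p n) < e" if "N \<le> m" "N \<le> n" for m n
      by (rule power2_less_imp_less) (use close[OF that] N e in auto)
    then show "\<exists>M. \<forall>m\<ge>M. \<forall>n\<ge>M. dist (p m) (p n) < e" by blast
  qed
  then show ?thesis using p by blast
qed

lemma complex_subspace_closure:
  fixes S :: "'a::complex_inner set"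
  assumes "complex_vector.subspace S"
  shows "complex_vector.subspace (closure S)"
proof (rule complex_vector.subspaceI)
  show "0 \<in> closure S"
    using complex_vector.subspace_0[OF assms] closure_subset by blast
next
  fix x y assume "x \<in> closure S" "y \<in> closure S"
  then obtain f g where "\<And>n. f n \<in> S" "f \<longlonglongrightarrow> x" "\<And>n. g n \<in> S" "g \<longlonglongrightarrow> y"
    unfolding closure_sequential by blast
  then show "x + y \<in> closure S"
    unfolding closure_sequential
    by (intro exI[of _ "\<lambda>n. f n + g n"]) (auto intro: tendsto_add complex_vector.subspace_add[OF assms])
next
  fix c x assume "x \<in> closure S"
  then obtain f where "\<And>n. f n \<in> S" "f \<longlonglongrightarrow> x"
    unfolding closure_sequential by blast
  then show "c *\<^sub>C x \<in> closure S"
    unfolding closure_sequential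
    by (intro exI[of _ "\<lambda>n. c *\<^sub>C f n"])
      (auto intro: bounded_clinear_tendsto[OF bounded_clinear_scaleC_left] complex_vector.subspace_scale[OF assms])
qed

lemma complex_subspace_scaleR: "complex_vector.subspace S \<Longrightarrow> x \<in> S \<Longrightarrow> r *\<^sub>R x \<in> S"
  by (simp add: scaleR_eq_scaleC complex_vector.subspace_scale)

context power_bounded
begin

definition Z :: "'a set"
  where "Z = closure (range A)"

definition Pr :: "'a \<Rightarrow> 'a"
  where "Pr = proj_along (Fix T) Z"

lemma Fix_eq: "Fix T = {x. A x = 0}"
  by (simp add: Fix_def A_def)

lemma T_pow_Fix: "x \<in> Fix T \<Longrightarrow> (T ^^ n) x = x"
  by (induction n) (simp_all add: Fix_def)

lemma A_mem_Z: "A x \<in> Z"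
  unfolding Z_def by (rule subsetD[OF closure_subset rangeI])

lemma closed_Z: "closed Z"
  by (simp add: Z_def)

lemma subspace_Z: "complex_vector.subspace Z"
  unfolding Z_def
proof (rule complex_subspace_closure, rule complex_vector.subspaceI)
  show "0 \<in> range A" using bounded_clinear_zero[OF A_clinear] by (metis rangeI)
  show "x + y \<in> range A" if "x \<in> range A" "y \<in> range A" for x y
    using that by (auto simp: bounded_clinear_add[OF A_clinear, symmetric])
  show "c *\<^sub>C x \<in> range A" if "x \<in> range A" for c x
    using that by (auto simp: bounded_clinear_scaleC[OF A_clinear, symmetric])
qed

lemma diff_T_pow_mem_Z: "x - (T ^^ n) x \<in> Z"
  using A_mem_Z by (simp add: A_sum_T_pow[symmetric])

lemma subspace_Fix: "complex_vector.subspace (Fix T)"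
  unfolding Fix_eq
  by (rule complex_vector.subspaceI)
    (simp_all add: bounded_clinear_zero[OF A_clinear] bounded_clinear_add[OF A_clinear]
      bounded_clinear_scaleC[OF A_clinear])

lemma closed_Fix: "closed (Fix T)"
  unfolding Fix_eq
  using continuous_closed_vimage[of "{0}" A] bounded_clinear_continuous[OF A_clinear]
  by (simp add: continuous_on_eq_continuous_at vimage_def)

end

text \<open>Strong convergence of \<open>T\<^sup>n A\<close> to \<open>0\<close> is the property from which the ergodic decomposition is
  derived.\<close>

locale asymptotically_regular = power_bounded +
  assumes regular: "(\<lambda>n. (T ^^ n) (A x)) \<longlonglongrightarrow> 0"
begin

text \<open>True on the range of \<open>A\<close> by assumption, and passed on to its closure by power-boundedness.\<close>

lemma T_pow_tendsto_0:
  assumes "z \<in> Z"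
  shows "(\<lambda>n. (T ^^ n) z) \<longlonglongrightarrow> 0"
proof (rule LIMSEQ_I)
  fix r :: real assume r: "r > 0"
  then obtain y where y: "dist (A y) z < r / (2 * K)"
    using assms K_ge_1 unfolding Z_def closure_approachable by (auto dest!: spec[of _ "r / (2 * K)"])
  have "K * dist (A y) z < r / 2" using y K_ge_1 by (simp add: field_simps)
  moreover obtain N where N: "\<And>n. n \<ge> N \<Longrightarrow> norm ((T ^^ n) (A y)) < r / 2"
    using LIMSEQ_D[OF regular[of y], of "r / 2"] r by auto
  have "norm ((T ^^ n) z - 0) < r" if "n \<ge> N" for n
  proof -
    have "(T ^^ n) z = (T ^^ n) (A y) + (T ^^ n) (z - A y)"
      by (simp add: bounded_clinear_diff[OF T_pow_clinear])
    then have "norm ((T ^^ n) z) \<le> norm ((T ^^ n) (A y)) + K * norm (z - A y)"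
      using norm_triangle_ineq[of "(T ^^ n) (A y)" "(T ^^ n) (z - A y)"] power_bound[of n "z - A y"] by simp
    then show ?thesis
      using N[OF that] \<open>K * dist (A y) z < r / 2\<close> by (simp add: dist_norm norm_minus_commute)
  qed
  then show "\<exists>no. \<forall>n\<ge>no. norm ((T ^^ n) z - 0) < r" by blast
qed

text \<open>An orbit in the intersection is constant and tends to \<open>0\<close>.\<close>

lemma Fix_Int_Z: "Fix T \<inter> Z = {0}"
proof -
  have "x = 0" if "x \<in> Fix T" "x \<in> Z" for x
    using T_pow_tendsto_0[OF that(2)] that(1) by (simp add: T_pow_Fix LIMSEQ_const_iff)
  then show ?thesis
    using complex_vector.subspace_0[OF subspace_Fix] complex_vector.subspace_0[OF subspace_Z] by auto
qed

text \<open>Among the \<open>v\<close> with \<open>x - v \<in> Z\<close> consider those that are almost fixed by \<open>T\<close>. These convex sets are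
  nonempty and bounded, because they contain the late orbit points \<open>T\<^sup>n x\<close>. A limit of points of almost
  minimal norm is the fixed point sought.\<close>

lemma exists_Fix_component: "\<exists>m\<in>Fix T. x - m \<in> Z"
proof -
  define S where "S k = {v. x - v \<in> Z \<and> norm (A v) \<le> 1 / real (Suc k)}" for k
  have "\<exists>p. (\<forall>k. p k \<in> S k) \<and> Cauchy p"
  proof (rule decreasing_convex_Cauchy_selection)
    show "convex (S k)" for k
    proof (rule convexI)
      fix v w :: 'a and s t :: real
      assume v: "v \<in> S k" and w: "w \<in> S k" and st: "0 \<le> s" "0 \<le> t" "s + t = 1"
      have "x - (s *\<^sub>R v + t *\<^sub>R w) = s *\<^sub>R (x - v) + t *\<^sub>R (x - w)"
        using st(3) by (simp add: scaleR_diff_right scaleR_add_left[symmetric] algebra_simps)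
      moreover have "norm (A (s *\<^sub>R v + t *\<^sub>R w)) \<le> s * norm (A v) + t * norm (A w)"
        using norm_triangle_ineq[of "s *\<^sub>R A v" "t *\<^sub>R A w"] st
        by (simp add: bounded_clinear_add[OF A_clinear] bounded_clinear_scaleR[OF A_clinear])
      moreover have "s * norm (A v) + t * norm (A w) \<le> s * (1 / real (Suc k)) + t * (1 / real (Suc k))"
        using v w st by (intro add_mono mult_left_mono) (auto simp: S_def)
      moreover have "s * (1 / real (Suc k)) + t * (1 / real (Suc k)) = 1 / real (Suc k)"
        using st(3) by (metis distrib_right mult_1)
      ultimately show "s *\<^sub>R v + t *\<^sub>R w \<in> S k"
        using v w by (auto simp: S_def intro!: complex_vector.subspace_add[OF subspace_Z]
            complex_subspace_scaleR[OF subspace_Z])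
    qed
    show "decseq S"
    proof (rule decseq_SucI)
      have "1 / real (Suc (Suc k)) \<le> 1 / real (Suc k)" for k by (intro divide_left_mono) auto
      then show "S (Suc k) \<subseteq> S k" for k unfolding S_def using order_trans by blast
    qed
    show "\<exists>v\<in>S k. norm v \<le> K * norm x" for k
    proof -
      obtain n where "norm ((T ^^ n) (A x)) < 1 / real (Suc k)"
        using LIMSEQ_D[OF regular[of x], of "1 / real (Suc k)"] by auto
      then have "(T ^^ n) x \<in> S k"
        by (simp add: S_def diff_T_pow_mem_Z T_pow_A)
      then show ?thesis using power_bound by blast
    qed
  qed
  then obtain p where p: "\<And>k. p k \<in> S k" and "Cauchy p" by blast
  then obtain m where m: "p \<longlonglongrightarrow> m" using Cauchy_convergent convergent_def by blast
  have "(\<lambda>k. norm (A (p k))) \<longlonglongrightarrow> 0"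
  proof (rule tendsto_sandwich[OF _ _ tendsto_const])
    show "\<forall>\<^sub>F k in sequentially. norm (A (p k)) \<le> 1 / real (Suc k)" using p by (simp add: S_def)
    show "(\<lambda>k. 1 / real (Suc k)) \<longlonglongrightarrow> 0" using LIMSEQ_Suc[OF lim_1_over_n] by simp
  qed simp
  then have "(\<lambda>k. A (p k)) \<longlonglongrightarrow> 0" by (rule tendsto_norm_zero_cancel)
  moreover have "(\<lambda>k. A (p k)) \<longlonglongrightarrow> A m" by (rule bounded_clinear_tendsto[OF A_clinear m])
  ultimately have "A m = 0" using LIMSEQ_unique by blast
  moreover have "x - m \<in> Z"
    by (rule closed_sequentially[OF closed_Z, of "\<lambda>k. x - p k"])
      (use p m in \<open>auto simp: S_def intro: tendsto_diff\<close>)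
  ultimately show ?thesis by (auto simp: Fix_eq)
qed

lemma Pr_eqI:
  assumes "m \<in> Fix T" "x - m \<in> Z"
  shows "Pr x = m"
  unfolding Pr_def proj_along_def
proof (rule the_equality)
  show "m \<in> Fix T \<and> x - m \<in> Z" using assms by blast
  fix m' assume m': "m' \<in> Fix T \<and> x - m' \<in> Z"
  have "m' - m \<in> Fix T"
    using assms m' complex_vector.subspace_diff[OF subspace_Fix] by blast
  moreover have "(x - m) - (x - m') \<in> Z"
    using assms m' complex_vector.subspace_diff[OF subspace_Z] by blast
  then have "m' - m \<in> Z" by simp
  ultimately have "m' - m \<in> Fix T \<inter> Z" by blast
  then show "m' = m" by (simp only: Fix_Int_Z singleton_iff right_minus_eq)
qed

lemma Pr_mem_Fix: "Pr x \<in> Fix T" and diff_Pr_mem_Z: "x - Pr x \<in> Z"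
  using exists_Fix_component[of x] Pr_eqI by auto

lemma direct_sum_Fix_Z: "direct_sum_decomp (Fix T) Z"
  unfolding direct_sum_decomp_def
proof (intro conjI allI subspace_Fix closed_Fix subspace_Z closed_Z Fix_Int_Z)
  show "\<exists>m\<in>Fix T. \<exists>n\<in>Z. x = m + n" for x
    using Pr_mem_Fix[of x] diff_Pr_mem_Z[of x] by (intro bexI[of _ "Pr x"] bexI[of _ "x - Pr x"]) auto
qed

lemma T_pow_diff_Pr: "(T ^^ n) (x - Pr x) = (T ^^ n) x - Pr x"
  by (simp add: bounded_clinear_diff[OF T_pow_clinear] T_pow_Fix[OF Pr_mem_Fix])

lemma T_pow_tendsto_Pr: "(\<lambda>n. (T ^^ n) x) \<longlonglongrightarrow> Pr x"
  using T_pow_tendsto_0[OF diff_Pr_mem_Z] by (simp add: T_pow_diff_Pr LIM_zero_iff)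

lemma Pr_of_Z: "z \<in> Z \<Longrightarrow> Pr z = 0"
  by (rule Pr_eqI) (simp_all add: complex_vector.subspace_0[OF subspace_Fix])

lemma norm_Pr_le: "norm (Pr x) \<le> K * norm x"
  by (rule LIMSEQ_le_const2[OF tendsto_norm[OF T_pow_tendsto_Pr]]) (use power_bound in blast)

lemma Pr_clinear: "bounded_clinear Pr"
proof (rule bounded_clinearI)
  show "Pr (x + y) = Pr x + Pr y" for x y
    using tendsto_add[OF T_pow_tendsto_Pr T_pow_tendsto_Pr, of x y] T_pow_tendsto_Pr[of "x + y"]
    by (simp add: bounded_clinear_add[OF T_pow_clinear] LIMSEQ_unique)
  show "Pr (c *\<^sub>C x) = c *\<^sub>C Pr x" for c x
    using bounded_clinear_tendsto[OF bounded_clinear_scaleC_left T_pow_tendsto_Pr, of c x]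
      T_pow_tendsto_Pr[of "c *\<^sub>C x"]
    by (simp add: bounded_clinear_scaleC[OF T_pow_clinear] LIMSEQ_unique)
qed (rule norm_Pr_le)

lemma A_Pr: "A (Pr x) = 0"
  using Pr_mem_Fix[of x] by (simp add: Fix_eq)

lemma A_diff_Pr: "A (x - Pr x) = A x"
  by (simp add: bounded_clinear_diff[OF A_clinear] A_Pr)

end

section \<open>Polynomial decay on ranges of powers\<close>

context power_bounded
begin

text \<open>The equation reads \<open>v = r y + r T v\<close> with \<open>r = 1/(1+s)\<close>. Iterating it bounds \<open>v\<close> by the Neumann series
  \<open>\<Sum> r\<^bsup>k+1\<^esup> \<parallel>T\<^sup>k y\<parallel>\<close>, whose coefficients sum to \<open>1/s\<close>; the remainder \<open>r\<^sup>n T\<^sup>n v\<close> tends to \<open>0\<close>.\<close>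

lemma resolvent_estimate:
  assumes s: "s > 0" and v: "s *\<^sub>R v + A v = y"
  shows "s * norm v \<le> K * norm y"
proof -
  define r where "r = 1 / (1 + s)"
  have r: "0 < r" "r < 1" using s by (auto simp: r_def)
  have step: "v = r *\<^sub>R y + r *\<^sub>R T v"
  proof -
    have "y + T v = (1 + s) *\<^sub>R v" by (simp add: v[symmetric] A_def scaleR_add_left)
    then have "r *\<^sub>R (y + T v) = v" using s by (simp add: r_def)
    then show ?thesis by (simp add: scaleR_add_right)
  qed
  have iterate: "v = (\<Sum>k<n. r ^ Suc k *\<^sub>R (T ^^ k) y) + r ^ n *\<^sub>R (T ^^ n) v" for n
  proof (induction n)
    case (Suc n)
    have "r ^ n *\<^sub>R (T ^^ n) v = r ^ n *\<^sub>R (T ^^ n) (r *\<^sub>R y + r *\<^sub>R T v)"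
      using step by simp
    also have "\<dots> = r ^ Suc n *\<^sub>R (T ^^ n) y + r ^ Suc n *\<^sub>R (T ^^ Suc n) v"
      by (simp add: bounded_clinear_add[OF T_pow_clinear] bounded_clinear_scaleR[OF T_pow_clinear]
          scaleR_add_right funpow_swap1 mult.commute)
    finally show ?case using Suc by (simp add: add.assoc)
  qed simp
  have le: "norm v \<le> K * norm y / s + r ^ n * (K * norm v)" for n
  proof -
    have "norm (\<Sum>k<n. r ^ Suc k *\<^sub>R (T ^^ k) y) \<le> (\<Sum>k<n. r ^ Suc k * (K * norm y))"
    proof (rule sum_norm_le)
      fix k
      show "norm (r ^ Suc k *\<^sub>R (T ^^ k) y) \<le> r ^ Suc k * (K * norm y)"
        using r mult_left_mono[OF power_bound[of k y], of "r ^ Suc k"] by simp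
    qed
    also have "\<dots> = r * (\<Sum>k<n. r ^ k) * (K * norm y)"
      by (simp add: sum_distrib_left sum_distrib_right)
    also have "\<dots> = (r * (1 - r ^ n) / (1 - r)) * (K * norm y)"
      using r by (simp add: sum_gp_strict)
    also have "\<dots> \<le> (1 / s) * (K * norm y)"
    proof (rule mult_right_mono)
      have "r / (1 - r) = 1 / s" using s by (simp add: r_def field_simps)
      then have "r * (1 - r ^ n) / (1 - r) = (1 / s) * (1 - r ^ n)"
        by (metis times_divide_eq_left)
      also have "\<dots> \<le> 1 / s" using r s by (simp add: field_simps)
      finally show "r * (1 - r ^ n) / (1 - r) \<le> 1 / s" .
    qed (use K_ge_1 in simp)
    finally have "norm (\<Sum>k<n. r ^ Suc k *\<^sub>R (T ^^ k) y) \<le> K * norm y / s" by simp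
    moreover have "norm (r ^ n *\<^sub>R (T ^^ n) v) \<le> r ^ n * (K * norm v)"
      using r mult_left_mono[OF power_bound[of n v], of "r ^ n"] by simp
    ultimately show ?thesis
      using norm_triangle_ineq[of "\<Sum>k<n. r ^ Suc k *\<^sub>R (T ^^ k) y" "r ^ n *\<^sub>R (T ^^ n) v"]
      unfolding iterate[of n, symmetric] by linarith
  qed
  have "(\<lambda>n. K * norm y / s + r ^ n * (K * norm v)) \<longlonglongrightarrow> K * norm y / s + 0 * (K * norm v)"
    using r by (intro tendsto_intros LIMSEQ_realpow_zero) auto
  then have "norm v \<le> K * norm y / s"
    using LIMSEQ_le_const[of _ "K * norm y / s" "norm v"] le by auto
  then show ?thesis using s by (simp add: field_simps)
qed

text \<open>The solution is the sum of the Neumann series.\<close>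

lemma resolvent_surj:
  assumes s: "s > 0"
  shows "\<exists>v. s *\<^sub>R v + A v = y"
proof -
  define r where "r = 1 / (1 + s)"
  have r: "0 < r" "r < 1" using s by (auto simp: r_def)
  define f where "f n = r ^ n *\<^sub>R (T ^^ n) y" for n
  have "summable (\<lambda>n. r ^ n * (K * norm y))"
    using r by (intro summable_mult2 summable_geometric) simp
  moreover have "norm (f n) \<le> r ^ n * (K * norm y)" for n
    using r mult_left_mono[OF power_bound[of n y], of "r ^ n"] by (simp add: f_def)
  ultimately have f: "summable f" by (rule summable_comparison_test'[where N = 0])
  have "r *\<^sub>R T (suminf f) = r *\<^sub>R (\<Sum>n. T (f n))"
    using bounded_linear.suminf[OF bounded_clinear_linear[OF T_clinear] f] by simp
  also have "\<dots> = (\<Sum>n. r *\<^sub>R T (f n))"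
    by (rule bounded_linear.suminf[OF bounded_linear_scaleR_right
          bounded_linear.summable[OF bounded_clinear_linear[OF T_clinear] f]])
  also have "(\<lambda>n. r *\<^sub>R T (f n)) = (\<lambda>n. f (Suc n))"
    by (simp add: f_def bounded_clinear_scaleR[OF T_clinear])
  also have "(\<Sum>n. f (Suc n)) = suminf f - y"
    using suminf_split_head[OF f] by (simp add: f_def)
  finally have "r *\<^sub>R T (suminf f) = suminf f - y" .
  then have "suminf f - r *\<^sub>R T (suminf f) = y" by simp
  moreover have "s *\<^sub>R (r *\<^sub>R u) + A (r *\<^sub>R u) = u - r *\<^sub>R T u" for u
  proof -
    have "s *\<^sub>R (r *\<^sub>R u) + A (r *\<^sub>R u) = (s * r + r) *\<^sub>R u - r *\<^sub>R T u"
      by (simp add: A_def bounded_clinear_scaleR[OF T_clinear] scaleR_add_left)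
    also have "s * r + r = 1" using s by (simp add: r_def field_simps)
    finally show ?thesis by simp
  qed
  ultimately show ?thesis by metis
qed

text \<open>Apply \<open>resolvent_estimate\<close> after \<open>T\<^sup>n A\<^sup>k\<close>, once to the equation for \<open>v\<close> and once to the
  equation \<open>(s + A)(y - v) = s y\<close>. The first bound is good for large \<open>s\<close>, the second for small \<open>s\<close>.\<close>

lemma T_pow_A_pow_bounds:
  assumes s: "s > 0" and v: "s *\<^sub>R v + A v = A y"
  shows "s * norm ((T ^^ n) ((A ^^ k) v)) \<le> K * norm ((T ^^ n) ((A ^^ Suc k) y))"
    and "norm ((T ^^ n) ((A ^^ k) v)) \<le> (1 + K) * norm ((T ^^ n) ((A ^^ k) y))"
proof -
  let ?L = "\<lambda>x. (T ^^ n) ((A ^^ k) x)"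
  have L: "bounded_clinear ?L" by (rule bounded_clinear_compose[OF T_pow_clinear A_pow_clinear])
  have LA: "?L (A x) = A (?L x)" for x by (simp only: funpow_swap1[symmetric] T_pow_A)
  have bound: "s * norm (?L u) \<le> K * norm (?L g)" if "s *\<^sub>R u + A u = g" for u g
  proof (rule resolvent_estimate[OF s])
    show "s *\<^sub>R ?L u + A (?L u) = ?L g"
      by (simp only: that[symmetric] bounded_clinear_add[OF L] bounded_clinear_scaleR[OF L] LA)
  qed
  show "s * norm (?L v) \<le> K * norm ((T ^^ n) ((A ^^ Suc k) y))"
    using bound[OF v] by (simp add: funpow_swap1)
  have "s *\<^sub>R (y - v) + A (y - v) = s *\<^sub>R y"
    using v by (simp add: bounded_clinear_diff[OF A_clinear] algebra_simps)
  from bound[OF this] have "s * norm (?L (y - v)) \<le> s * (K * norm (?L y))"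
    by (simp only: bounded_clinear_scaleR[OF L] norm_scaleR abs_of_pos[OF s] mult.left_commute)
  then have "norm (?L (y - v)) \<le> K * norm (?L y)" using s by simp
  moreover have "norm (?L v) \<le> norm (?L y) + norm (?L (y - v))"
    using norm_triangle_ineq4[of "?L y" "?L (y - v)"] by (simp add: bounded_clinear_diff[OF L])
  ultimately show "norm (?L v) \<le> (1 + K) * norm (?L y)" by (simp add: algebra_simps)
qed

text \<open>A moment inequality with a free parameter \<open>s\<close>: in Balakrishnan's integral the two bounds of the previous
  lemma are used below and above \<open>s\<close>. With \<open>s = n\<^bsup>-1/\<alpha>\<^esup>\<close> it interpolates between the rates for \<open>A\<^sup>k\<close> and
  \<open>A\<^bsup>k+1\<^esup>\<close>.\<close>

lemma balakrishnan_moment_bound: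
  assumes \<delta>: "0 < \<delta>" "\<delta> < 1" and s: "s > 0"
  shows "norm ((T ^^ n) ((A ^^ k) (balakrishnan A \<delta> y)))
    \<le> (1 + K) * norm ((T ^^ n) ((A ^^ k) y)) * (s powr \<delta> / \<delta>)
      + K * norm ((T ^^ n) ((A ^^ Suc k) y)) * (s powr (\<delta> - 1) / (1 - \<delta>))"
    (is "_ \<le> ?a * _ + ?b * _")
proof -
  let ?L = "\<lambda>x. (T ^^ n) ((A ^^ k) x)"
  have L: "bounded_clinear ?L" by (rule bounded_clinear_compose[OF T_pow_clinear A_pow_clinear])
  define v where "v u = inv (\<lambda>y. u *\<^sub>R y + A y) (A y)" for u
  have v: "u *\<^sub>R v u + A (v u) = A y" if "u > 0" for u
  proof -
    have "surj (\<lambda>y. u *\<^sub>R y + A y)" using resolvent_surj[OF that] unfolding surj_def by metis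
    from surj_f_inv_f[OF this, of "A y"] show ?thesis by (simp add: v_def)
  qed
  define f where "f u = u powr (\<delta> - 1) *\<^sub>R v u" for u
  \<comment> \<open>An integrable majorant of \<open>\<parallel>T\<^sup>n A\<^sup>k f(u)\<parallel>\<close>: \<open>g1\<close> is used below \<open>s\<close> and \<open>g2\<close> above.\<close>
  define g1 where "g1 u = (if u \<in> {0..s} then ?a * u powr (\<delta> - 1) else 0)" for u
  define g2 where "g2 u = (if u \<in> {s..} then ?b * u powr (\<delta> - 2) else 0)" for u
  have "(g1 has_integral ?a * (s powr \<delta> / \<delta>)) {0..}"
    unfolding g1_def using has_integral_mult_right[OF has_integral_powr_from_0[of "\<delta> - 1" s], of ?a] \<delta> s
    by (subst has_integral_restrict) auto
  moreover have "(g2 has_integral ?b * (s powr (\<delta> - 1) / (1 - \<delta>))) {0..}"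
  proof -
    have exponent: "\<delta> - 2 + 1 = \<delta> - 1" by simp
    have value_eq: "- (s powr (\<delta> - 1)) / (\<delta> - 1) = s powr (\<delta> - 1) / (1 - \<delta>)"
      using \<delta> by (simp add: field_simps)
    have "((\<lambda>u. u powr (\<delta> - 2)) has_integral - (s powr (\<delta> - 2 + 1)) / (\<delta> - 2 + 1)) {s..}"
      using \<delta> s by (intro has_integral_powr_to_inf) auto
    then have "((\<lambda>u. u powr (\<delta> - 2)) has_integral s powr (\<delta> - 1) / (1 - \<delta>)) {s..}"
      by (simp only: exponent value_eq)
    from has_integral_mult_right[OF this, of ?b] show ?thesis
      unfolding g2_def using s by (subst has_integral_restrict) auto
  qed
  ultimately have "((\<lambda>u. g1 u + g2 u) has_integral ?a * (s powr \<delta> / \<delta>) + ?b * (s powr (\<delta> - 1) / (1 - \<delta>))) {0..}"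
    by (rule has_integral_add)
  then have g: "((\<lambda>u. g1 u + g2 u) has_integral ?a * (s powr \<delta> / \<delta>) + ?b * (s powr (\<delta> - 1) / (1 - \<delta>))) {0<..}"
    by (subst has_integral_spike_set_eq[where T = "{0..}"]) (auto intro: negligible_subset[of "{0}"])
  have f_le: "norm (?L (f u)) \<le> g1 u + g2 u" if u: "u \<in> {0<..}" for u
  proof -
    have Lf: "norm (?L (f u)) = u powr (\<delta> - 1) * norm (?L (v u))"
      by (simp add: f_def bounded_clinear_scaleR[OF L])
    have nonneg: "0 \<le> g1 u" "0 \<le> g2 u" using K_ge_1 by (simp_all add: g1_def g2_def)
    show ?thesis
    proof (cases "u \<le> s")
      case True
      have "u powr (\<delta> - 1) * norm (?L (v u)) \<le> u powr (\<delta> - 1) * ?a"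
        using T_pow_A_pow_bounds(2)[OF _ v] u by (intro mult_left_mono) auto
      then have "norm (?L (f u)) \<le> g1 u" using True u by (simp add: Lf g1_def mult.commute)
      then show ?thesis using nonneg by linarith
    next
      case False
      have "u powr (\<delta> - 1) * norm (?L (v u)) = u powr (\<delta> - 2) * (u * norm (?L (v u)))"
        using u powr_mult_base[of u "\<delta> - 2"] by (simp add: mult_ac)
      also have "\<dots> \<le> u powr (\<delta> - 2) * ?b"
        using T_pow_A_pow_bounds(1)[OF _ v] u by (intro mult_left_mono) auto
      finally have "norm (?L (f u)) \<le> g2 u" using False by (simp add: Lf g2_def mult.commute)
      then show ?thesis using nonneg by linarith
    qed
  qed
  have "norm (?L (integral {0<..} f)) \<le> integral {0<..} (\<lambda>u. g1 u + g2 u)"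
  proof (cases "f integrable_on {0<..}")
    case True
    have "?L (integral {0<..} f) = integral {0<..} (?L \<circ> f)"
      by (rule integral_linear[OF True bounded_clinear_linear[OF L], symmetric])
    moreover have "(?L \<circ> f) integrable_on {0<..}"
      by (rule integrable_linear[OF True bounded_clinear_linear[OF L]])
    ultimately show ?thesis
      using integral_norm_bound_integral[of "?L \<circ> f" "{0<..}" "\<lambda>u. g1 u + g2 u"] f_le g
      by (auto simp: has_integral_integrable)
  next
    case False
    \<comment> \<open>The integral of a function that is not integrable is \<open>0\<close> by convention, and then the bound is trivial.\<close>
    have "0 \<le> integral {0<..} (\<lambda>u. g1 u + g2 u)"
      by (rule integral_nonneg) (use g K_ge_1 in \<open>auto simp: g1_def g2_def intro: has_integral_integrable\<close>)
    then show ?thesis using False by (simp add: not_integrable_integral bounded_clinear_zero[OF L])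
  qed
  moreover have "norm (?L (balakrishnan A \<delta> y)) \<le> norm (?L (integral {0<..} f))"
  proof -
    have "?L (balakrishnan A \<delta> y) = (sin (pi * \<delta>) / pi) *\<^sub>R ?L (integral {0<..} f)"
      unfolding balakrishnan_def f_def[abs_def] v_def bounded_clinear_scaleR[OF L] ..
    moreover have "\<bar>sin (pi * \<delta>) / pi\<bar> \<le> 1"
    proof -
      have "\<bar>sin (pi * \<delta>)\<bar> \<le> pi" using abs_sin_le_one[of "pi * \<delta>"] pi_gt3 by linarith
      then show ?thesis by simp
    qed
    ultimately show ?thesis
      using mult_right_mono[of "\<bar>sin (pi * \<delta>) / pi\<bar>" 1 "norm (?L (integral {0<..} f))"] by simp
  qed
  ultimately show ?thesis using integral_unique[OF g] by linarith
qed

end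

sublocale resolvent_growth \<subseteq> asymptotically_regular
proof
  fix x :: 'a
  obtain C\<^sub>0 where C\<^sub>0: "\<And>n x. n > 0 \<Longrightarrow> norm ((T ^^ n) (A x)) \<le> C\<^sub>0 * real n powr (- 1 / \<alpha>) * norm x"
    using Katznelson_Tzafriri_rate by blast
  have "(\<lambda>n. real n powr (- 1 / \<alpha>)) \<longlonglongrightarrow> 0"
    using \<alpha>_ge_1 by (intro tendsto_neg_powr filterlim_real_sequentially) simp
  then have "(\<lambda>n. C\<^sub>0 * real n powr (- 1 / \<alpha>) * norm x) \<longlonglongrightarrow> 0"
    by (intro tendsto_mult_left_zero tendsto_mult_right_zero)
  moreover have "\<forall>\<^sub>F n in sequentially. norm ((T ^^ n) (A x)) \<le> C\<^sub>0 * real n powr (- 1 / \<alpha>) * norm x"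
    using eventually_gt_at_top[of 0] by eventually_elim (rule C\<^sub>0)
  ultimately show "(\<lambda>n. (T ^^ n) (A x)) \<longlonglongrightarrow> 0"
    by (rule Lim_null_comparison[rotated])
qed

context resolvent_growth
begin

text \<open>With \<open>h = n div (k + 1)\<close> the basic rate is applied to each of the \<open>k\<close> factors \<open>T\<^sup>h A\<close>. The remaining
  \<open>T\<^sup>h z\<close> tends to \<open>0\<close>, which improves \<open>O\<close> to \<open>o\<close>.\<close>

lemma A_pow_decay:
  assumes z: "z \<in> Z"
  shows "(\<lambda>n. real n powr (real k / \<alpha>) * norm ((T ^^ n) ((A ^^ k) z))) \<longlonglongrightarrow> 0"
proof -
  obtain C\<^sub>0 where C\<^sub>0: "C\<^sub>0 \<ge> 0"
    and rate: "\<And>n x. n > 0 \<Longrightarrow> norm ((T ^^ n) (A x)) \<le> C\<^sub>0 * real n powr (- 1 / \<alpha>) * norm x"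
    using Katznelson_Tzafriri_rate by blast
  have rate_pow: "norm ((((T ^^ h) \<circ> A) ^^ j) x) \<le> (C\<^sub>0 * real h powr (- 1 / \<alpha>)) ^ j * norm x"
    if "h > 0" for h j x
  proof (induction j)
    case (Suc j)
    have "norm ((((T ^^ h) \<circ> A) ^^ Suc j) x) \<le> C\<^sub>0 * real h powr (- 1 / \<alpha>) * norm ((((T ^^ h) \<circ> A) ^^ j) x)"
      using rate[OF that] by simp
    also have "\<dots> \<le> C\<^sub>0 * real h powr (- 1 / \<alpha>) * ((C\<^sub>0 * real h powr (- 1 / \<alpha>)) ^ j * norm x)"
      by (rule mult_left_mono[OF Suc.IH]) (simp add: C\<^sub>0)
    finally show ?case by (simp only: power_Suc mult.assoc)
  qed simp
  define c where "c = K * C\<^sub>0 ^ k * real (2 * Suc k) powr (real k / \<alpha>)"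
  have bound: "real n powr (real k / \<alpha>) * norm ((T ^^ n) ((A ^^ k) z)) \<le> c * norm ((T ^^ (n div Suc k)) z)"
    if n: "n \<ge> Suc k" for n
  proof -
    define h where "h = n div Suc k"
    have h: "h > 0" using n by (simp add: h_def div_greater_zero_iff)
    have h_le: "h * Suc k \<le> n" unfolding h_def by (rule div_times_less_eq_dividend)
    have "n < Suc k * Suc h"
      unfolding h_def using dividend_less_times_div[of "Suc k" n] by simp
    also have "\<dots> \<le> Suc k * (2 * h)" using h by (intro mult_le_mono2) simp
    finally have n_le: "n \<le> 2 * Suc k * h" by (simp add: mult_ac)
    have "norm ((T ^^ n) ((A ^^ k) z)) \<le> K * norm ((T ^^ (h * k + h)) ((A ^^ k) z))"
      using h_le by (intro norm_T_pow_mono) simp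
    also have "(T ^^ (h * k + h)) ((A ^^ k) z) = (((T ^^ h) \<circ> A) ^^ k) ((T ^^ h) z)"
      unfolding T_pow_add T_pow_A_pow[of h] T_pow_A_pow_mult ..
    also have "K * norm \<dots> \<le> K * ((C\<^sub>0 * real h powr (- 1 / \<alpha>)) ^ k * norm ((T ^^ h) z))"
      using K_ge_1 by (intro mult_left_mono rate_pow h) simp
    finally have "norm ((T ^^ n) ((A ^^ k) z)) \<le> K * ((C\<^sub>0 * real h powr (- 1 / \<alpha>)) ^ k * norm ((T ^^ h) z))" .
    moreover have "real n powr (real k / \<alpha>) \<le> (real (2 * Suc k) * real h) powr (real k / \<alpha>)"
    proof (rule powr_mono2)
      show "real n \<le> real (2 * Suc k) * real h"
        using n_le by (metis of_nat_le_iff of_nat_mult)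
    qed (use \<alpha>_ge_1 in simp_all)
    ultimately have "real n powr (real k / \<alpha>) * norm ((T ^^ n) ((A ^^ k) z))
      \<le> (real (2 * Suc k) * real h) powr (real k / \<alpha>) * (K * ((C\<^sub>0 * real h powr (- 1 / \<alpha>)) ^ k * norm ((T ^^ h) z)))"
      by (intro mult_mono) auto
    also have "\<dots> = c * (real h powr (real k / \<alpha>) * (real h powr (- 1 / \<alpha>)) ^ k) * norm ((T ^^ h) z)"
      by (simp only: c_def powr_mult power_mult_distrib mult_ac)
    also have "(real h powr (- 1 / \<alpha>)) ^ k = real h powr (- (real k / \<alpha>))"
      using h by (simp add: powr_powr powr_realpow[symmetric])
    also have "real h powr (real k / \<alpha>) * real h powr (- (real k / \<alpha>)) = 1"
      using h by (simp add: powr_add[symmetric])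
    finally show ?thesis by (simp add: h_def)
  qed
  have "(\<lambda>n. c * norm ((T ^^ (n div Suc k)) z)) \<longlonglongrightarrow> 0"
  proof (rule tendsto_mult_right_zero)
    have "(\<lambda>n. (T ^^ (n div Suc k)) z) \<longlonglongrightarrow> 0"
      by (rule filterlim_compose[OF T_pow_tendsto_0[OF z] filterlim_at_top_div_const_nat]) simp
    then show "(\<lambda>n. norm ((T ^^ (n div Suc k)) z)) \<longlonglongrightarrow> 0" by (rule tendsto_norm_zero)
  qed
  moreover have "\<forall>\<^sub>F n in sequentially. norm (real n powr (real k / \<alpha>) * norm ((T ^^ n) ((A ^^ k) z)))
      \<le> c * norm ((T ^^ (n div Suc k)) z)"
    using eventually_ge_at_top[of "Suc k"] by eventually_elim (use bound in simp)
  ultimately show ?thesis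
    by (rule Lim_null_comparison[rotated])
qed

text \<open>For \<open>\<gamma> > 0\<close> the vector enters \<open>A\<^sup>\<gamma>\<close> only through its image under \<open>A\<close>, and \<open>A\<close> kills fixed points.\<close>

lemma frac_power_diff_Pr:
  assumes "\<gamma> > 0"
  shows "frac_power A \<gamma> (y - Pr y) = frac_power A \<gamma> y"
proof (cases "frac \<gamma> = 0")
  case True
  then have "\<gamma> = of_int \<lfloor>\<gamma>\<rfloor>" by (simp add: frac_def)
  then have "nat \<lfloor>\<gamma>\<rfloor> > 0" using assms by linarith
  then obtain k where k: "nat \<lfloor>\<gamma>\<rfloor> = Suc k" by (cases "nat \<lfloor>\<gamma>\<rfloor>") auto
  show ?thesis
    using True by (simp add: frac_power_def k funpow_Suc_right A_diff_Pr del: funpow.simps)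
next
  case False
  then show ?thesis by (simp add: frac_power_def balakrishnan_def A_diff_Pr)
qed

theorem frac_power_decay:
  assumes \<gamma>: "\<gamma> > 0"
  shows "(\<lambda>n. real n powr (\<gamma> / \<alpha>) * norm ((T ^^ n) (frac_power A \<gamma> y))) \<longlonglongrightarrow> 0"
proof -
  define z where "z = y - Pr y"
  have z: "z \<in> Z" unfolding z_def by (rule diff_Pr_mem_Z)
  have y_z: "frac_power A \<gamma> y = frac_power A \<gamma> z"
    unfolding z_def using \<gamma> by (rule frac_power_diff_Pr[symmetric])
  define k where "k = nat \<lfloor>\<gamma>\<rfloor>"
  define \<delta> where "\<delta> = frac \<gamma>"
  have k_\<delta>: "\<gamma> = real k + \<delta>" using \<gamma> by (simp add: k_def \<delta>_def frac_def)
  show ?thesis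
  proof (cases "\<delta> = 0")
    case True
    then have \<gamma>_eq: "\<gamma> = real k" using k_\<delta> by simp
    have "frac_power A \<gamma> y = (A ^^ k) z"
      using True unfolding y_z by (simp add: frac_power_def k_def \<delta>_def)
    then show ?thesis using A_pow_decay[OF z, of k] unfolding \<gamma>_eq[symmetric] by simp
  next
    case False
    then have \<delta>: "0 < \<delta>" "\<delta> < 1" by (simp_all add: \<delta>_def less_le frac_lt_1)
      (metis frac_ge_0 frac_lt_1 less_le)+
    have frac_eq: "frac_power A \<gamma> y = (A ^^ k) (balakrishnan A \<delta> z)"
      using False unfolding y_z by (simp add: frac_power_def k_def \<delta>_def)
    define a where "a n = real n powr (real k / \<alpha>) * norm ((T ^^ n) ((A ^^ k) z))" for n
    define b where "b n = real n powr (real (Suc k) / \<alpha>) * norm ((T ^^ n) ((A ^^ Suc k) z))" for n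
    have "a \<longlonglongrightarrow> 0" "b \<longlonglongrightarrow> 0" unfolding a_def b_def by (rule A_pow_decay[OF z])+
    then have "(\<lambda>n. (1 + K) / \<delta> * a n + K / (1 - \<delta>) * b n) \<longlonglongrightarrow> 0"
      by (intro tendsto_add_zero tendsto_mult_right_zero)
    moreover have "real n powr (\<gamma> / \<alpha>) * norm ((T ^^ n) (frac_power A \<gamma> y)) \<le> (1 + K) / \<delta> * a n + K / (1 - \<delta>) * b n"
      if n: "n > 0" for n
    proof -
      let ?u = "norm ((T ^^ n) ((A ^^ k) z))" and ?w = "norm ((T ^^ n) ((A ^^ Suc k) z))"
      define s where "s = real n powr (- 1 / \<alpha>)"
      have s: "s > 0" using n by (simp add: s_def)
      have "real n powr (\<gamma> / \<alpha>) * norm ((T ^^ n) (frac_power A \<gamma> y))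
        \<le> real n powr (\<gamma> / \<alpha>) * ((1 + K) * ?u * (s powr \<delta> / \<delta>) + K * ?w * (s powr (\<delta> - 1) / (1 - \<delta>)))"
        unfolding frac_eq by (intro mult_left_mono balakrishnan_moment_bound \<delta> s) simp
      also have "\<dots> = (1 + K) / \<delta> * (real n powr (\<gamma> / \<alpha>) * s powr \<delta> * ?u)
          + K / (1 - \<delta>) * (real n powr (\<gamma> / \<alpha>) * s powr (\<delta> - 1) * ?w)"
        by (simp add: algebra_simps add_divide_distrib)
      also have "real n powr (\<gamma> / \<alpha>) * s powr \<delta> = real n powr (real k / \<alpha>)"
        by (simp add: s_def powr_powr powr_add[symmetric] k_\<delta> add_divide_distrib)
      also have "real n powr (\<gamma> / \<alpha>) * s powr (\<delta> - 1) = real n powr (real (Suc k) / \<alpha>)"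
      proof -
        have "\<gamma> / \<alpha> + - 1 / \<alpha> * (\<delta> - 1) = real (Suc k) / \<alpha>"
          using \<alpha>_ge_1 by (simp add: k_\<delta> field_simps)
        then show ?thesis by (simp only: s_def powr_powr powr_add[symmetric])
      qed
      finally show ?thesis by (simp only: a_def b_def)
    qed
    then have "\<forall>\<^sub>F n in sequentially. norm (real n powr (\<gamma> / \<alpha>) * norm ((T ^^ n) (frac_power A \<gamma> y)))
        \<le> (1 + K) / \<delta> * a n + K / (1 - \<delta>) * b n"
      by (intro eventually_mono[OF eventually_gt_at_top[of 0]]) simp
    ultimately show ?thesis by (rule Lim_null_comparison[rotated])
  qed
qed

end

section \<open>Rapid decay on a dense set\<close>

context asymptotically_regular
begin

lemma A_pow_mem_Z: "z \<in> Z \<Longrightarrow> (A ^^ k) z \<in> Z"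
  by (cases k) (simp_all add: A_mem_Z)

text \<open>Changing \<open>y\<close> by its fixed component does not change \<open>A y\<close>.\<close>

lemma A_image_Z_dense:
  assumes "z \<in> Z" "e > 0"
  shows "\<exists>y\<in>Z. dist (A y) z < e"
proof -
  obtain y where "dist (A y) z < e"
    using assms unfolding Z_def closure_approachable by auto
  then show ?thesis
    using diff_Pr_mem_Z by (intro bexI[of _ "y - Pr y"]) (simp_all add: A_diff_Pr)
qed

lemma norm_A_pow_le: "norm ((A ^^ n) x) \<le> (1 + K) ^ n * norm x"
proof (induction n)
  case (Suc n)
  have "norm ((A ^^ Suc n) x) \<le> (1 + K) * norm ((A ^^ n) x)"
    using norm_A_le by simp
  also have "\<dots> \<le> (1 + K) * ((1 + K) ^ n * norm x)"
    using K_ge_1 by (intro mult_left_mono Suc.IH) simp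
  finally show ?case by simp
qed simp

text \<open>Starting from \<open>z\<close>, choose successive approximate preimages \<open>y\<^sub>k\<close> under \<open>A\<close> in \<open>Z\<close>, with errors small enough to
  survive \<open>k\<close> further applications of \<open>A\<close>. Then \<open>w\<^sub>j = lim A\<^sup>n y\<^bsub>j+n\<^esub>\<close> exists and \<open>A w\<^bsub>j+1\<^esub> = w\<^sub>j\<close>
  holds exactly, so \<open>w\<^sub>0\<close> lies in the range of every power of \<open>A\<close>.\<close>

lemma Mittag_Leffler_dense:
  assumes z: "z \<in> Z" and e: "e > 0"
  shows "\<exists>w. dist w z < e \<and> (\<forall>k. w \<in> (A ^^ k) ` Z)"
proof -
  \<comment> \<open>The error at step \<open>k\<close> is magnified at most by \<open>\<parallel>A\<parallel>\<^sup>k \<le> (1 + K)\<^sup>k\<close> and must then be summable.\<close>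
  define \<eta> where "\<eta> k = e * (1/2) ^ (k + 2) / (1 + K) ^ k" for k
  have "\<eta> k > 0" for k using e K_ge_1 by (simp add: \<eta>_def)
  then have "\<exists>g. \<forall>k y. y \<in> Z \<longrightarrow> g k y \<in> Z \<and> dist (A (g k y)) y < \<eta> k"
    using A_image_Z_dense by (intro choice allI) (metis)
  then obtain g where g: "\<And>k y. y \<in> Z \<Longrightarrow> g k y \<in> Z" "\<And>k y. y \<in> Z \<Longrightarrow> dist (A (g k y)) y < \<eta> k"
    by blast
  define y where "y = rec_nat z g"
  have y_Z: "y k \<in> Z" for k
    by (induction k) (simp_all add: y_def z g)
  have y_Suc: "dist (A (y (Suc k))) (y k) < \<eta> k" for k
    using g(2)[OF y_Z[of k], of k] by (simp add: y_def)
  define s where "s j n = (A ^^ n) (y (j + n))" for j n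
  define d where "d j n = s j (Suc n) - s j n" for j n
  have d_le: "norm (d j n) \<le> e / 4 * (1/2) ^ n" for j n
  proof -
    have "d j n = (A ^^ n) (A (y (Suc (j + n))) - y (j + n))"
      by (simp add: d_def s_def bounded_clinear_diff[OF A_pow_clinear] funpow_swap1)
    then have "norm (d j n) \<le> (1 + K) ^ n * norm (A (y (Suc (j + n))) - y (j + n))"
      using norm_A_pow_le by simp
    also have "\<dots> \<le> (1 + K) ^ n * \<eta> (j + n)"
      using K_ge_1 y_Suc[of "j + n"] by (intro mult_left_mono) (auto simp: dist_norm)
    also have "\<dots> = e / 4 * (1/2) ^ n * ((1/2) ^ j / (1 + K) ^ j)"
      using K_ge_1 by (simp add: \<eta>_def power_add field_simps power2_eq_square)
    also have "\<dots> \<le> e / 4 * (1/2) ^ n * 1"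
    proof (rule mult_left_mono)
      have "(1/2) ^ j \<le> (1::real)" by (rule power_le_one) auto
      also have "1 \<le> (1 + K) ^ j" using K_ge_1 by (intro one_le_power) simp
      finally show "(1/2) ^ j / (1 + K) ^ j \<le> 1" using K_ge_1 by (simp add: field_simps)
    qed (use e in simp)
    finally show ?thesis by simp
  qed
  have geom: "(\<lambda>n. e / 4 * (1/2) ^ n) sums (e / 4 * 2)"
    using sums_mult[OF geometric_sums[of "1/2 :: real"], of "e / 4"] by simp
  have d_summable: "summable (d j)" for j
    by (rule summable_comparison_test'[OF sums_summable[OF geom], where N = 0]) (rule d_le)
  define w where "w j = y j + suminf (d j)" for j
  have s_w: "s j \<longlonglongrightarrow> w j" for j
  proof -
    have "(\<Sum>i<n. d j i) = s j n - s j 0" for n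
      unfolding d_def by (rule sum_lessThan_telescope)
    then have "s j = (\<lambda>n. y j + (\<Sum>i<n. d j i))" by (auto simp: s_def)
    then show ?thesis
      unfolding w_def using tendsto_add[OF tendsto_const summable_LIMSEQ[OF d_summable]] by simp
  qed
  have w_Z: "w j \<in> Z" for j
    by (rule closed_sequentially[OF closed_Z _ s_w]) (simp add: s_def A_pow_mem_Z y_Z)
  have A_w: "A (w (Suc j)) = w j" for j
  proof (rule LIMSEQ_unique)
    show "(\<lambda>n. s j (Suc n)) \<longlonglongrightarrow> w j" by (rule LIMSEQ_Suc[OF s_w])
    show "(\<lambda>n. s j (Suc n)) \<longlonglongrightarrow> A (w (Suc j))"
      using bounded_clinear_tendsto[OF A_clinear s_w[of "Suc j"]] by (simp add: s_def)
  qed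
  have "w 0 = (A ^^ k) (w k)" for k
    by (induction k) (simp_all only: funpow_0 funpow_Suc_right comp_apply A_w)
  then have "w 0 \<in> (A ^^ k) ` Z" for k using w_Z by blast
  moreover have "dist (w 0) z < e"
  proof -
    have "norm (suminf (d 0)) \<le> (\<Sum>n. e / 4 * (1/2) ^ n)"
      by (rule norm_suminf_le[OF d_le sums_summable[OF geom]])
    also have "\<dots> < e" using sums_unique[OF geom] e by simp
    finally show ?thesis by (simp add: w_def y_def dist_norm)
  qed
  ultimately show ?thesis by blast
qed

end

section \<open>Exponential decay and closed range\<close>

text \<open>If \<open>f\<close> is large at \<open>u\<close>, it is large at \<open>x + u\<close> or at \<open>x - u\<close>, because these values differ by
  \<open>2 f(u)\<close>.\<close>

lemma exists_large_translate:
  fixes f :: "'a::real_normed_vector \<Rightarrow> 'b::real_normed_vector"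
  assumes f: "bounded_linear f" and r: "r > 0" and c: "0 \<le> c" "c < onorm f"
  shows "\<exists>u. norm u \<le> r \<and> norm (f (x + u)) \<ge> r * c"
proof -
  interpret bounded_linear f by (rule f)
  obtain v where v: "c * norm v < norm (f v)"
    using onorm_bound[of c f] c by (meson not_le)
  have "v \<noteq> 0" using v by (auto simp: zero)
  define u where "u = (r / norm v) *\<^sub>R v"
  have u: "norm u = r" using r \<open>v \<noteq> 0\<close> by (simp add: u_def)
  have "norm (f u) = r / norm v * norm (f v)" using r by (simp add: u_def scaleR)
  moreover have "r / norm v * (c * norm v) \<le> r / norm v * norm (f v)"
    using r v by (intro mult_left_mono) auto
  ultimately have fu: "r * c \<le> norm (f u)" using \<open>v \<noteq> 0\<close> by simp
  have "f (x + u) - f (x - u) = 2 *\<^sub>R f u"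
    by (simp add: add diff scaleR_2)
  then have "2 * norm (f u) \<le> norm (f (x + u)) + norm (f (x - u))"
    using norm_triangle_ineq4[of "f (x + u)" "f (x - u)"] by simp
  then have "norm (f (x + u)) \<ge> r * c \<or> norm (f (x + - u)) \<ge> r * c"
    using fu by auto
  then show ?thesis using u by (metis norm_minus_cancel order_refl)
qed

text \<open>Sokal's gliding hump. If the norms are unbounded, choose members of the family with norm above \<open>4\<^sup>k\<close>
  and build \<open>x\<close> by steps of length at most \<open>3\<^sup>-\<^sup>k\<close>, the \<open>k\<close>-th one making the \<open>k\<close>-th member at least
  \<open>2/3\<close> of its norm times \<open>3\<^sup>-\<^sup>k\<close>. The later steps have total length at most half of \<open>3\<^sup>-\<^sup>k\<close> and cannot undo
  this, since \<open>2/3 > 1/2\<close>, so the values at \<open>x\<close> are at least \<open>(4/3)\<^sup>k / 6\<close>.\<close>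

theorem uniform_boundedness_principle:
  fixes L :: "nat \<Rightarrow> 'a::banach \<Rightarrow> 'b::real_normed_vector"
  assumes L: "\<And>n. bounded_linear (L n)" and pointwise: "\<And>x. \<exists>c. \<forall>n. norm (L n x) \<le> c"
  shows "\<exists>c. \<forall>n x. norm (L n x) \<le> c * norm x"
proof (rule ccontr)
  assume unbounded: "\<not> ?thesis"
  have "\<exists>n. c < onorm (L n)" if "0 \<le> c" for c
  proof (rule ccontr)
    assume "\<not> ?thesis"
    then have "norm (L n x) \<le> c * norm x" for n x
      using onorm[OF L, of n x] mult_right_mono[of "onorm (L n)" c "norm x"] by (force simp: not_less)
    then show False using unbounded by blast
  qed
  then have "\<forall>k. \<exists>n. 4 ^ k < onorm (L n)" by simp
  then obtain m where m: "\<And>k. 4 ^ k < onorm (L (m k))" using choice by meson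
  define M where "M k = onorm (L (m k))" for k
  have M: "4 ^ k < M k" for k using m by (simp add: M_def)
  have M_pos: "0 < M k" for k using M[of k] zero_less_power[of "4::real" k] by linarith
  have "\<exists>u. norm u \<le> (1/3) ^ k \<and> norm (L (m k) (x + u)) \<ge> (1/3) ^ k * (2/3 * M k)" for k x
    by (rule exists_large_translate[OF L]) (use M_pos[of k] in \<open>auto simp flip: M_def\<close>)
  then obtain g where g: "\<And>k x. norm (g k x) \<le> (1/3) ^ k"
      "\<And>k x. norm (L (m k) (x + g k x)) \<ge> (1/3) ^ k * (2/3 * M k)"
    by metis
  define X where "X = rec_nat 0 (\<lambda>k x. x + g k x)"
  define u where "u k = g k (X k)" for k
  have X_Suc: "X (Suc k) = X k + u k" for k by (simp add: X_def u_def)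
  have X_sum: "X k = (\<Sum>j<k. u j)" for k
    by (induction k) (simp_all add: X_Suc, simp add: X_def)
  have u_le: "norm (u k) \<le> (1/3) ^ k" for k by (simp add: u_def g)
  have u: "summable u"
    by (rule summable_comparison_test'[OF summable_geometric[of "1/3 :: real"], where N = 0]) (simp_all add: u_le)
  define x where "x = suminf u"
  have tail: "norm (x - X (Suc k)) \<le> (1/3) ^ k / 2" for k
  proof -
    have "(\<lambda>j. (1/3) ^ Suc k * (1/3 :: real) ^ j) sums ((1/3) ^ Suc k * (1 / (1 - 1/3)))"
      by (intro sums_mult geometric_sums) simp
    then have geom: "(\<lambda>j. (1/3 :: real) ^ (j + Suc k)) sums ((1/3) ^ k / 2)"
      by (simp add: power_add mult_ac)
    have "x - X (Suc k) = (\<Sum>j. u (j + Suc k))"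
      unfolding x_def X_sum using suminf_minus_initial_segment[OF u, of "Suc k"] by simp
    also have "norm \<dots> \<le> (\<Sum>j. (1/3) ^ (j + Suc k))"
      by (rule norm_suminf_le[OF u_le sums_summable[OF geom]])
    finally show ?thesis by (simp only: sums_unique[OF geom])
  qed
  have big: "(4/3) ^ k / 6 \<le> norm (L (m k) x)" for k
  proof -
    interpret bounded_linear "L (m k)" by (rule L)
    have "norm (L (m k) (x - X (Suc k))) \<le> M k * norm (x - X (Suc k))"
      unfolding M_def by (rule onorm[OF L])
    also have "\<dots> \<le> M k * ((1/3) ^ k / 2)"
      using M_pos[of k] by (intro mult_left_mono tail) simp
    finally have "norm (L (m k) (x - X (Suc k))) \<le> M k * ((1/3) ^ k / 2)" .
    moreover have "norm (L (m k) (X (Suc k))) \<ge> (1/3) ^ k * (2/3 * M k)"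
      using g(2)[of k "X k"] by (simp add: X_Suc u_def)
    moreover have "norm (L (m k) (X (Suc k))) \<le> norm (L (m k) x) + norm (L (m k) (x - X (Suc k)))"
      using norm_triangle_ineq4[of "L (m k) x" "L (m k) (x - X (Suc k))"] by (simp add: diff)
    ultimately have "(1/3) ^ k * M k / 6 \<le> norm (L (m k) x)"
      by (simp add: mult.commute[of "M k"])
    moreover have "(1/3) ^ k * 4 ^ k \<le> (1/3) ^ k * M k"
      using M[of k] by (intro mult_left_mono) auto
    moreover have "(1/3) ^ k * 4 ^ k = (4/3 :: real) ^ k"
      by (simp add: power_mult_distrib[symmetric])
    ultimately show ?thesis by linarith
  qed
  obtain c where c: "\<And>n. norm (L n x) \<le> c" using pointwise by blast
  obtain k where "6 * c < (4/3) ^ k" using real_arch_pow[of "4/3" "6 * c"] by auto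
  then show False using big[of k] c[of "m k"] by linarith
qed

context power_bounded
begin

lemma T_pow_mem_Z: "z \<in> Z \<Longrightarrow> (T ^^ n) z \<in> Z"
  using complex_vector.subspace_diff[OF subspace_Z _ diff_T_pow_mem_Z, of z z n] by simp

text \<open>On \<open>Z\<close> the series \<open>\<Sum> T\<^sup>n z\<close> converges, and \<open>A\<close> maps its sum to \<open>z\<close>; hence \<open>A\<close> has range \<open>Z\<close>.\<close>

lemma closed_range_if_exponential_decay:
  assumes \<beta>: "\<beta> > 0" and decay: "\<And>n z. z \<in> Z \<Longrightarrow> norm ((T ^^ n) z) \<le> M * exp (- \<beta> * real n) * norm z"
  shows "closed (range A)"
proof -
  have "z \<in> range A" if z: "z \<in> Z" for z
  proof -
    define f where "f n = (T ^^ n) z" for n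
    have "summable (\<lambda>n. M * norm z * exp (- \<beta>) ^ n)"
      using \<beta> by (intro summable_mult summable_geometric) simp
    moreover have "norm (f n) \<le> M * norm z * exp (- \<beta>) ^ n" for n
      using decay[OF z, of n] by (simp add: f_def exp_of_nat_mult[symmetric] mult_ac)
    ultimately have f: "summable f"
      by (rule summable_comparison_test'[where N = 0])
    have "T (suminf f) = (\<Sum>n. f (Suc n))"
      using bounded_linear.suminf[OF bounded_clinear_linear[OF T_clinear] f] by (simp add: f_def[abs_def])
    also have "\<dots> = suminf f - z" using suminf_split_head[OF f] by (simp add: f_def)
    finally have "A (suminf f) = z" by (simp add: A_def)
    then show ?thesis by blast
  qed
  then have "range A = Z" using A_mem_Z by auto
  then show ?thesis using closed_Z by simp
qed

lemma exponential_decay_of_contraction: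
  assumes N: "N > 0" and half: "\<And>z. z \<in> Z \<Longrightarrow> norm ((T ^^ N) z) \<le> norm z / 2" and z: "z \<in> Z"
  shows "norm ((T ^^ n) z) \<le> 2 * K * exp (- (ln 2 / real N) * real n) * norm z"
proof -
  have "norm ((T ^^ (j * N)) z) \<le> (1/2) ^ j * norm z" for j
  proof (induction j)
    case (Suc j)
    then show ?case
      using half[OF T_pow_mem_Z[OF z, of "j * N"]] by (simp add: T_pow_add)
  qed simp
  then have "K * norm ((T ^^ (n div N * N)) z) \<le> K * ((1/2) ^ (n div N) * norm z)"
    using K_ge_1 by (intro mult_left_mono) auto
  then have "norm ((T ^^ n) z) \<le> K * ((1/2) ^ (n div N) * norm z)"
    using norm_T_pow_mono[of "n div N * N" n z] by simp
  also have "(1/2) ^ (n div N) \<le> 2 * exp (- (ln 2 / real N) * real n)"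
  proof -
    have "n < N * Suc (n div N)" using dividend_less_times_div[OF N, of n] by simp
    then have "real n \<le> real N * (real (n div N) + 1)"
      by (metis of_nat_Suc of_nat_le_iff of_nat_mult less_imp_le add.commute)
    then have "real n / real N - 1 \<le> real (n div N)" using N by (simp add: field_simps)
    then have "ln 2 * (real n / real N - 1) \<le> ln 2 * real (n div N)"
      by (intro mult_left_mono) auto
    then have "exp (- (ln 2 * real (n div N))) \<le> exp (ln 2 + - (ln 2 / real N) * real n)"
      by (simp add: algebra_simps)
    also have "\<dots> = 2 * exp (- (ln 2 / real N) * real n)" by (simp only: exp_add exp_ln zero_less_numeral)
    also have "exp (- (ln 2 * real (n div N))) = (1/2) ^ (n div N)"
      by (simp add: exp_minus exp_of_nat2_mult power_divide inverse_eq_divide)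
    finally show ?thesis .
  qed
  finally show ?thesis
    using K_ge_1 by (simp add: mult_right_mono mult_left_mono mult_ac)
qed

end

context resolvent_growth
begin

text \<open>If the range is closed it is all of \<open>Z\<close>, so \<open>x - Pr x\<close> is some \<open>A y\<close> and the basic rate bounds
  \<open>n\<^bsup>1/\<alpha>\<^esup> T\<^sup>n (x - Pr x)\<close> for each \<open>x\<close>. By uniform boundedness the constant is uniform, and it is beaten by
  \<open>n\<^bsup>1/\<alpha>\<^esup>\<close> for large \<open>n\<close>.\<close>

lemma contraction_if_closed_range:
  assumes closed: "closed (range A)"
  shows "\<exists>N>0. \<forall>z\<in>Z. norm ((T ^^ N) z) \<le> norm z / 2"
proof -
  obtain C\<^sub>0 where C\<^sub>0: "C\<^sub>0 \<ge> 0"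
    and rate: "\<And>n x. n > 0 \<Longrightarrow> norm ((T ^^ n) (A x)) \<le> C\<^sub>0 * real n powr (- 1 / \<alpha>) * norm x"
    using Katznelson_Tzafriri_rate by blast
  define L where "L n x = real n powr (1 / \<alpha>) *\<^sub>R (T ^^ n) (x - Pr x)" for n x
  have "\<exists>c. \<forall>n x. norm (L n x) \<le> c * norm x"
  proof (rule uniform_boundedness_principle)
    show "bounded_linear (L n)" for n
      unfolding L_def
      by (intro bounded_clinear_linear bounded_clinear_fun_scaleR bounded_clinear_minus
          bounded_clinear_compose[OF T_pow_clinear] bounded_clinear_id Pr_clinear)
    show "\<exists>c. \<forall>n. norm (L n x) \<le> c" for x
    proof -
      have "x - Pr x \<in> range A" using diff_Pr_mem_Z[of x] closed by (simp add: Z_def)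
      then obtain y where y: "x - Pr x = A y" by auto
      have "norm (L n x) \<le> C\<^sub>0 * norm y" for n
      proof (cases "n = 0")
        case True
        then show ?thesis using C\<^sub>0 by (simp add: L_def)
      next
        case False
        have "norm (L n x) \<le> real n powr (1 / \<alpha>) * (C\<^sub>0 * real n powr (- 1 / \<alpha>) * norm y)"
          using rate[of n y] False by (simp add: L_def y mult_left_mono)
        also have "\<dots> = C\<^sub>0 * (real n powr (1 / \<alpha>) * real n powr (- 1 / \<alpha>)) * norm y"
          by simp
        also have "real n powr (1 / \<alpha>) * real n powr (- 1 / \<alpha>) = 1"
          using False by (simp add: powr_add[symmetric])
        finally show ?thesis by simp
      qed
      then show ?thesis by blast
    qed
  qed
  then obtain c where c: "\<And>n x. norm (L n x) \<le> c * norm x" by blast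
  have "filterlim (\<lambda>n. real n powr (1 / \<alpha>)) at_top sequentially"
    using \<alpha>_ge_1 by (intro filterlim_compose[OF real_powr_at_top filterlim_real_sequentially]) simp
  then have "\<forall>\<^sub>F n in sequentially. 2 * c \<le> real n powr (1 / \<alpha>) \<and> n > 0"
    by (intro eventually_conj eventually_gt_at_top) (simp add: filterlim_at_top)
  then obtain N where N: "2 * c \<le> real N powr (1 / \<alpha>)" "N > 0"
    unfolding eventually_sequentially by blast
  have "norm ((T ^^ N) z) \<le> norm z / 2" if z: "z \<in> Z" for z
  proof -
    have "real N powr (1 / \<alpha>) * norm ((T ^^ N) z) \<le> c * norm z"
      using c[of N z] by (simp add: L_def Pr_of_Z[OF z])
    also have "\<dots> \<le> real N powr (1 / \<alpha>) / 2 * norm z"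
      using N by (intro mult_right_mono) auto
    finally have "real N powr (1 / \<alpha>) * norm ((T ^^ N) z) \<le> real N powr (1 / \<alpha>) * (norm z / 2)" by simp
    then show ?thesis using N by (simp only: mult_le_cancel_left_pos powr_gt_zero of_nat_0_less_iff)
  qed
  then show ?thesis using N by blast
qed

end

section \<open>From the resolvent hypothesis to a lower bound on the unit circle\<close>

lemma norm_le_resolvent:
  assumes "\<mu> \<notin> spectrum T"
  shows "norm x \<le> onorm (resolvent \<mu> T) * norm (\<mu> *\<^sub>C x - T x)" and "0 \<le> onorm (resolvent \<mu> T)"
proof -
  obtain S where S: "bounded_clinear S" "\<And>x. S (\<mu> *\<^sub>C x - T x) = x" "\<And>x. \<mu> *\<^sub>C S x - T (S x) = x"
    using assms by (auto simp: spectrum_def)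
  have "resolvent \<mu> T = S"
    unfolding resolvent_def by (rule inv_equality) (rule S)+
  then show "norm x \<le> onorm (resolvent \<mu> T) * norm (\<mu> *\<^sub>C x - T x)" "0 \<le> onorm (resolvent \<mu> T)"
    using onorm[OF bounded_clinear_linear[OF S(1)], of "\<mu> *\<^sub>C x - T x"]
      onorm_pos_le[OF bounded_clinear_linear[OF S(1)]] by (simp_all add: S(2))
qed

text \<open>A lower bound for \<open>\<nu> - T\<close> persists, with twice the constant, on a small ball around \<open>\<nu>\<close>; finitely many
  such balls cover \<open>D\<close>.\<close>

lemma uniform_lower_bound_on_compact:
  fixes T :: "'a::complex_inner \<Rightarrow> 'a"
  assumes "compact D" and disj: "D \<inter> spectrum T = {}"
  shows "\<exists>c\<ge>0. \<forall>\<mu>\<in>D. \<forall>x. norm x \<le> c * norm (\<mu> *\<^sub>C x - T x)"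
proof -
  define c where "c \<mu> = onorm (resolvent \<mu> T) + 1" for \<mu>
  have c_pos: "c \<mu> > 0" if "\<mu> \<in> D" for \<mu>
    using norm_le_resolvent(2)[of \<mu> T] disj that unfolding c_def by fastforce
  obtain D' where D': "D' \<subseteq> D" "finite D'" and cover: "D \<subseteq> (\<Union>\<mu>\<in>D'. ball \<mu> (1 / (2 * c \<mu>)))"
  proof (rule compactE_image[OF \<open>compact D\<close>, of D "\<lambda>\<mu>. ball \<mu> (1 / (2 * c \<mu>))"])
    show "D \<subseteq> (\<Union>\<mu>\<in>D. ball \<mu> (1 / (2 * c \<mu>)))"
      using c_pos by (intro subsetI UN_I) auto
  qed auto
  have near: "norm x \<le> 2 * c \<nu> * norm (\<mu> *\<^sub>C x - T x)"
    if \<nu>: "\<nu> \<in> D'" and \<mu>: "\<mu> \<in> ball \<nu> (1 / (2 * c \<nu>))" for \<mu> \<nu> x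
  proof -
    have c\<nu>: "c \<nu> > 0" using c_pos \<nu> D' by blast
    have "\<nu> \<notin> spectrum T" using \<nu> D' disj by blast
    then have "norm x \<le> onorm (resolvent \<nu> T) * norm (\<nu> *\<^sub>C x - T x)"
      by (rule norm_le_resolvent(1))
    also have "\<dots> \<le> c \<nu> * norm (\<nu> *\<^sub>C x - T x)"
      by (rule mult_right_mono) (simp_all add: c_def)
    also have "\<nu> *\<^sub>C x - T x = (\<mu> *\<^sub>C x - T x) + (\<nu> - \<mu>) *\<^sub>C x"
      by (simp add: complex_vector.scale_left_diff_distrib)
    also have "c \<nu> * norm \<dots> \<le> c \<nu> * (norm (\<mu> *\<^sub>C x - T x) + cmod (\<nu> - \<mu>) * norm x)"
      using c\<nu> norm_triangle_ineq[of "\<mu> *\<^sub>C x - T x" "(\<nu> - \<mu>) *\<^sub>C x"]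
      by (intro mult_left_mono) (auto simp: norm_scaleC)
    also have "\<dots> = c \<nu> * norm (\<mu> *\<^sub>C x - T x) + c \<nu> * cmod (\<nu> - \<mu>) * norm x"
      by (simp add: algebra_simps)
    also have "\<dots> \<le> c \<nu> * norm (\<mu> *\<^sub>C x - T x) + 1 / 2 * norm x"
      using \<mu> c\<nu> by (intro add_left_mono mult_right_mono) (auto simp: dist_norm field_simps)
    finally show ?thesis by simp
  qed
  define C where "C = (\<Sum>\<nu>\<in>D'. 2 * c \<nu>)"
  have c_nonneg: "0 \<le> 2 * c \<nu>" if "\<nu> \<in> D'" for \<nu>
    using c_pos[of \<nu>] D' that by auto
  have "norm x \<le> C * norm (\<mu> *\<^sub>C x - T x)" if \<mu>: "\<mu> \<in> D" for \<mu> x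
  proof -
    obtain \<nu> where \<nu>: "\<nu> \<in> D'" "\<mu> \<in> ball \<nu> (1 / (2 * c \<nu>))" using cover \<mu> by blast
    have "2 * c \<nu> \<le> C"
      unfolding C_def by (rule member_le_sum) (use \<nu> D' c_nonneg in auto)
    then show ?thesis
      using near[OF \<nu>, of x] mult_right_mono[of "2 * c \<nu>" C "norm (\<mu> *\<^sub>C x - T x)"] by simp
  qed
  moreover have "C \<ge> 0" unfolding C_def by (rule sum_nonneg) (rule c_nonneg)
  ultimately show ?thesis by blast
qed

text \<open>For small angles \<open>\<theta>\<close> this is the growth hypothesis, as \<open>\<bar>e\<^bsup>i\<theta>\<^esup> - 1\<bar> \<le> \<bar>\<theta>\<bar>\<close>. The rest of the circle is
  compact and disjoint from the spectrum.\<close>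

lemma resolvent_lower_bound:
  fixes T :: "'a::complex_inner \<Rightarrow> 'a" and \<alpha> :: real
  assumes spec: "spectrum T \<inter> sphere 0 1 \<subseteq> {1}" and \<alpha>: "\<alpha> \<ge> 0"
    and growth: "(\<lambda>\<theta>. onorm (resolvent (exp (\<i> * complex_of_real \<theta>)) T)) \<in> O[at 0](\<lambda>\<theta>. \<bar>\<theta>\<bar> powr (- \<alpha>))"
  shows "\<exists>C\<ge>0. \<forall>\<mu> x. cmod \<mu> = 1 \<longrightarrow> \<mu> \<noteq> 1 \<longrightarrow>
    norm x \<le> C * cmod (\<mu> - 1) powr (- \<alpha>) * norm (\<mu> *\<^sub>C x - T x)"
proof -
  have not_spec: "\<mu> \<notin> spectrum T" if "cmod \<mu> = 1" "\<mu> \<noteq> 1" for \<mu>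
    using spec that by auto
  obtain c where c: "c > 0" and
    "\<forall>\<^sub>F \<theta> in at 0. norm (onorm (resolvent (exp (\<i> * complex_of_real \<theta>)) T)) \<le> c * norm (\<bar>\<theta>\<bar> powr (- \<alpha>))"
    by (rule landau_o.bigE[OF growth])
  then obtain d where d: "d > 0" and
    near: "\<forall>\<theta>. \<theta> \<noteq> 0 \<and> \<bar>\<theta>\<bar> < d \<longrightarrow> \<bar>onorm (resolvent (exp (\<i> * complex_of_real \<theta>)) T)\<bar> \<le> c * \<bar>\<theta>\<bar> powr (- \<alpha>)"
    unfolding eventually_at by (auto simp: dist_real_def)
  define D where "D = (\<lambda>\<theta>. exp (\<i> * complex_of_real \<theta>)) ` ({-pi..-d} \<union> {d..pi})"
  have "compact D"
    unfolding D_def by (intro compact_continuous_image compact_Un compact_Icc continuous_intros)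
  moreover have "D \<inter> spectrum T = {}"
  proof -
    have "exp (\<i> * complex_of_real \<theta>) \<notin> spectrum T" if \<theta>: "\<theta> \<in> {-pi..-d} \<union> {d..pi}" for \<theta>
    proof (rule not_spec)
      show "exp (\<i> * complex_of_real \<theta>) \<noteq> 1"
      proof
        assume "exp (\<i> * complex_of_real \<theta>) = 1"
        then have "cos \<theta> = 1" by (simp add: cis_conv_exp[symmetric] complex_eq_iff)
        then obtain n :: int where n: "\<theta> = of_int n * 2 * pi" unfolding cos_one_2pi_int by auto
        have "\<bar>\<theta>\<bar> \<le> pi" "\<theta> \<noteq> 0" using \<theta> d by auto
        then have "\<bar>real_of_int n\<bar> * (2 * pi) \<le> pi" "n \<noteq> 0" using n by (auto simp: abs_mult)
        moreover have "1 * (2 * pi) \<le> \<bar>real_of_int n\<bar> * (2 * pi)"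
          using \<open>n \<noteq> 0\<close> by (intro mult_right_mono) auto
        ultimately show False using pi_gt_zero by linarith
      qed
    qed simp
    then show ?thesis unfolding D_def by blast
  qed
  ultimately obtain c' where c': "c' \<ge> 0" and far: "\<And>\<mu> x. \<mu> \<in> D \<Longrightarrow> norm x \<le> c' * norm (\<mu> *\<^sub>C x - T x)"
    using uniform_lower_bound_on_compact[of D T] by blast
  have "norm x \<le> (c + c' * 2 powr \<alpha>) * cmod (\<mu> - 1) powr (- \<alpha>) * norm (\<mu> *\<^sub>C x - T x)"
    if \<mu>: "cmod \<mu> = 1" "\<mu> \<noteq> 1" for \<mu> x
  proof -
    define \<theta> where "\<theta> = Arg \<mu>"
    have "\<mu> \<noteq> 0" using \<mu> by auto
    then have \<mu>_eq: "\<mu> = exp (\<i> * complex_of_real \<theta>)"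
      using cis_Arg[of \<mu>] \<mu> by (simp add: \<theta>_def sgn_eq cis_conv_exp)
    have \<theta>: "\<theta> \<noteq> 0" "\<bar>\<theta>\<bar> \<le> pi"
      using \<mu>_eq \<mu> Arg_bounded[of \<mu>] by (auto simp: \<theta>_def)
    have \<rho>: "0 < cmod (\<mu> - 1)" "cmod (\<mu> - 1) \<le> 2"
      using \<mu> norm_triangle_ineq4[of \<mu> 1] by auto
    have "\<exists>b. norm x \<le> b * norm (\<mu> *\<^sub>C x - T x) \<and> b \<le> (c + c' * 2 powr \<alpha>) * cmod (\<mu> - 1) powr (- \<alpha>)"
    proof (cases "\<bar>\<theta>\<bar> < d")
      case True
      have "cmod (\<mu> - 1) \<le> \<bar>\<theta>\<bar>"
        using dist_exp_i_1[of \<theta>] abs_sin_x_le_abs_x[of "\<theta> / 2"] by (simp add: \<mu>_eq dist_norm)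
      then have "\<bar>\<theta>\<bar> powr (- \<alpha>) \<le> cmod (\<mu> - 1) powr (- \<alpha>)"
        using \<alpha> \<rho> by (intro powr_mono2') auto
      then have "c * \<bar>\<theta>\<bar> powr (- \<alpha>) \<le> (c + c' * 2 powr \<alpha>) * cmod (\<mu> - 1) powr (- \<alpha>)"
        using c c' by (intro mult_mono) auto
      moreover have "onorm (resolvent \<mu> T) \<le> c * \<bar>\<theta>\<bar> powr (- \<alpha>)"
        using near \<theta>(1) True unfolding \<mu>_eq by (meson abs_ge_self order_trans)
      ultimately show ?thesis
        using norm_le_resolvent(1)[OF not_spec[OF \<mu>]] order_trans by blast
    next
      case False
      then have "\<mu> \<in> D" unfolding D_def \<mu>_eq using \<theta> by (intro imageI) auto
      moreover have "1 \<le> 2 powr \<alpha> * cmod (\<mu> - 1) powr (- \<alpha>)"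
      proof -
        have "2 powr (- \<alpha>) \<le> cmod (\<mu> - 1) powr (- \<alpha>)"
          using \<alpha> \<rho> by (intro powr_mono2') auto
        then have "2 powr \<alpha> * 2 powr (- \<alpha>) \<le> 2 powr \<alpha> * cmod (\<mu> - 1) powr (- \<alpha>)"
          by (intro mult_left_mono) auto
        then show ?thesis by (simp add: powr_add[symmetric])
      qed
      then have "c' * 1 \<le> c' * (2 powr \<alpha> * cmod (\<mu> - 1) powr (- \<alpha>))"
        using c' by (intro mult_left_mono)
      then have "c' \<le> (c + c' * 2 powr \<alpha>) * cmod (\<mu> - 1) powr (- \<alpha>)"
        using c by (simp add: algebra_simps add_increasing)
      ultimately show ?thesis using far by blast
    qed
    then obtain b where "norm x \<le> b * norm (\<mu> *\<^sub>C x - T x)"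
      "b \<le> (c + c' * 2 powr \<alpha>) * cmod (\<mu> - 1) powr (- \<alpha>)" by blast
    then show ?thesis
      using mult_right_mono[of b _ "norm (\<mu> *\<^sub>C x - T x)"] order_trans norm_ge_zero by blast
  qed
  moreover have "c + c' * 2 powr \<alpha> \<ge> 0" using c c' by simp
  ultimately show ?thesis by blast
qed

section \<open>Periodic evolution families\<close>

locale periodic_evolution =
  fixes U :: "real \<Rightarrow> real \<Rightarrow> 'a::complex_hilbert_space \<Rightarrow> 'a" and \<tau> K :: real
  assumes evolution: "evolution_family U" and \<tau>_pos: "\<tau> > 0" and periodic: "periodic_family \<tau> U"
    and U_bound: "0 \<le> s \<Longrightarrow> s \<le> t \<Longrightarrow> norm (U t s x) \<le> K * norm x"
begin

lemma U_clinear: "0 \<le> s \<Longrightarrow> s \<le> t \<Longrightarrow> bounded_clinear (U t s)"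
  using evolution by (simp add: evolution_family_def)

lemma U_refl: "0 \<le> t \<Longrightarrow> U t t x = x"
  using evolution by (simp add: evolution_family_def)

lemma U_comp:
  assumes "0 \<le> s" "s \<le> r" "r \<le> t"
  shows "U t r (U r s x) = U t s x"
proof -
  have "U t r \<circ> U r s = U t s"
    using evolution assms by (simp add: evolution_family_def)
  from fun_cong[OF this, of x] show ?thesis by simp
qed

lemma U_shift:
  assumes "0 \<le> s" "s \<le> t"
  shows "U (t + real n * \<tau>) (s + real n * \<tau>) = U t s"
proof (induction n)
  case (Suc n)
  have "U ((t + real n * \<tau>) + \<tau>) ((s + real n * \<tau>) + \<tau>) = U (t + real n * \<tau>) (s + real n * \<tau>)"
    using periodic assms \<tau>_pos by (simp add: periodic_family_def)
  also have "\<dots> = U t s" by (rule Suc.IH)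
  finally show ?case by (simp add: algebra_simps)
qed simp

lemma monodromy_pow: "(U \<tau> 0 ^^ n) x = U (real n * \<tau>) 0 x"
proof (induction n)
  case 0
  then show ?case by (simp add: U_refl)
next
  case (Suc n)
  have "U (real (Suc n) * \<tau>) 0 x = U (\<tau> + real n * \<tau>) (0 + real n * \<tau>) (U (real n * \<tau>) 0 x)"
    using \<tau>_pos U_comp[of 0 "real n * \<tau>" "real (Suc n) * \<tau>" x] by (simp add: algebra_simps)
  also have "\<dots> = U \<tau> 0 (U (real n * \<tau>) 0 x)"
    using \<tau>_pos by (subst U_shift) auto
  finally show ?case by (simp add: Suc)
qed

definition periods :: "real \<Rightarrow> nat"
  where "periods t = nat \<lfloor>t / \<tau>\<rfloor>"

lemma periods_le: "0 \<le> t \<Longrightarrow> real (periods t) * \<tau> \<le> t"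
  using \<tau>_pos of_int_floor_le[of "t / \<tau>"] by (simp add: periods_def pos_le_divide_eq[symmetric])

lemma less_Suc_periods: "0 \<le> t \<Longrightarrow> t < (real (periods t) + 1) * \<tau>"
proof -
  assume t: "0 \<le> t"
  have "t / \<tau> < real (periods t) + 1"
    using floor_correct[of "t / \<tau>"] t \<tau>_pos by (simp add: periods_def)
  then show ?thesis using \<tau>_pos by (simp add: field_simps)
qed

lemma periods_at_top: "filterlim periods at_top at_top"
  unfolding periods_def
  by (rule filterlim_compose[OF filterlim_nat_sequentially])
    (rule filterlim_compose[OF filterlim_floor_sequentially],
      rule filterlim_at_top_mult_tendsto_pos[OF tendsto_const _ filterlim_ident, of "1 / \<tau>", simplified],
      rule \<tau>_pos)

text \<open>The solution passes through \<open>T\<^sup>n v\<close>, with \<open>n = periods t\<close>, and then runs for less than one period.\<close>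

lemma norm_solution_le:
  assumes t: "0 \<le> t"
  shows "norm (U t 0 v) \<le> K * norm ((U \<tau> 0 ^^ periods t) v)"
proof -
  have "U t 0 v = U t (real (periods t) * \<tau>) (U (real (periods t) * \<tau>) 0 v)"
    using t \<tau>_pos periods_le by (simp add: U_comp)
  then show ?thesis
    using U_bound[of "real (periods t) * \<tau>" t] periods_le[OF t] \<tau>_pos by (simp add: monodromy_pow)
qed

lemma solution_tendsto_0:
  assumes "(\<lambda>n. (U \<tau> 0 ^^ n) v) \<longlonglongrightarrow> 0"
  shows "((\<lambda>t. norm (U t 0 v)) \<longlongrightarrow> 0) at_top"
proof (rule Lim_null_comparison)
  show "\<forall>\<^sub>F t in at_top. norm (norm (U t 0 v)) \<le> K * norm ((U \<tau> 0 ^^ periods t) v)"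
    using eventually_ge_at_top[of 0] by eventually_elim (simp add: norm_solution_le)
  show "((\<lambda>t. K * norm ((U \<tau> 0 ^^ periods t) v)) \<longlongrightarrow> 0) at_top"
    by (intro tendsto_mult_right_zero tendsto_norm_zero filterlim_compose[OF assms periods_at_top])
qed

text \<open>A rate in the number of periods is a rate in time, since \<open>t \<le> 2 \<tau> (periods t)\<close> once a full period has
  passed.\<close>

lemma solution_smallo:
  assumes g: "g \<ge> 0" and decay: "(\<lambda>n. real n powr g * norm ((U \<tau> 0 ^^ n) v)) \<longlonglongrightarrow> 0"
  shows "(\<lambda>t. norm (U t 0 v)) \<in> o[at_top](\<lambda>t. t powr (- g))"
proof (rule smalloI_tendsto)
  show "\<forall>\<^sub>F t::real in at_top. t powr (- g) \<noteq> 0"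
    using eventually_gt_at_top[of 0] by eventually_elim simp
  show "((\<lambda>t. norm (U t 0 v) / t powr (- g)) \<longlongrightarrow> 0) at_top"
  proof (rule Lim_null_comparison)
    let ?h = "\<lambda>n. (2 * \<tau>) powr g * K * (real n powr g * norm ((U \<tau> 0 ^^ n) v))"
    show "((\<lambda>t. ?h (periods t)) \<longlongrightarrow> 0) at_top"
      by (intro tendsto_mult_right_zero filterlim_compose[OF decay periods_at_top])
    show "\<forall>\<^sub>F t in at_top. norm (norm (U t 0 v) / t powr (- g)) \<le> ?h (periods t)"
      using eventually_ge_at_top[of \<tau>]
    proof eventually_elim
      case (elim t)
      have t: "0 < t" using elim \<tau>_pos by linarith
      have "periods t > 0"
      proof (rule ccontr)
        assume "\<not> ?thesis"
        then show False using less_Suc_periods[of t] t elim by simp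
      qed
      then have "1 * \<tau> \<le> real (periods t) * \<tau>" using \<tau>_pos by (intro mult_right_mono) auto
      then have "t \<le> 2 * \<tau> * real (periods t)"
        using less_Suc_periods[of t] t by (simp add: algebra_simps)
      then have "t powr g \<le> (2 * \<tau> * real (periods t)) powr g"
        using t g by (intro powr_mono2) auto
      also have "\<dots> = (2 * \<tau>) powr g * real (periods t) powr g"
        using \<tau>_pos by (simp add: powr_mult)
      finally have "t powr g * norm (U t 0 v) \<le>
          ((2 * \<tau>) powr g * real (periods t) powr g) * (K * norm ((U \<tau> 0 ^^ periods t) v))"
        using t by (intro mult_mono norm_solution_le) auto
      moreover have "norm (norm (U t 0 v) / t powr (- g)) = t powr g * norm (U t 0 v)"
        by (simp add: powr_minus divide_inverse)
      ultimately show ?case by (simp add: mult_ac)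
    qed
  qed
qed

end

section \<open>Asymptotics of the solutions\<close>

text \<open>The difference of the two solutions at time \<open>t\<close> is \<open>U(t,0) (x - P x)\<close>, with \<open>x - P x \<in> Z\<close>; each part
  transfers a property of the orbits of the monodromy operator on \<open>Z\<close> to continuous time.\<close>

theorem theorem2p1:
  fixes U :: "real \<Rightarrow> real \<Rightarrow> 'a::complex_hilbert_space \<Rightarrow> 'a"
    and \<tau> \<alpha> :: real
  defines "T \<equiv> U \<tau> 0"
  defines "Z \<equiv> closure (range (\<lambda>x. x - T x))"
  defines "P \<equiv> proj_along (Fix T) Z"
  defines "z \<equiv> \<lambda>x. solution U x"
  defines "z\<^sub>0 \<equiv> \<lambda>x. solution U (P x)"
  assumes "evolution_family U"
    and "bounded_family U"
    and "\<tau> > 0" and "periodic_family \<tau> U"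
    and "spectrum T \<inter> sphere 0 1 \<subseteq> {1}"
    and "\<alpha> \<ge> 1"
    and "(\<lambda>\<theta>. onorm (resolvent (exp (\<i> * complex_of_real \<theta>)) T)) \<in> O[at 0](\<lambda>\<theta>. \<bar>\<theta>\<bar> powr (- \<alpha>))"
  shows "direct_sum_decomp (Fix T) Z \<and>
    \<comment> \<open>(i)\<close>
    (\<forall>x. ((\<lambda>t. norm (z x t - z\<^sub>0 x t)) \<longlongrightarrow> 0) at_top \<and>
         periodic_with \<tau> (z\<^sub>0 x) \<and> z\<^sub>0 x 0 = P x) \<and>
    asymptotically_periodic U \<and>
    (stable U \<longleftrightarrow> Fix T = {0}) \<and>
    \<comment> \<open>(ii)\<close>
    ((\<exists>M>0. \<exists>\<beta>>0. \<forall>t\<ge>0. \<forall>x. norm (z x t - z\<^sub>0 x t) \<le> M * exp (- \<beta> * t) * norm x)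
       \<longleftrightarrow> closed (range (\<lambda>x. x - T x))) \<and>
    \<comment> \<open>(iii)\<close>
    (\<forall>x. \<forall>\<gamma>>0. x - P x \<in> range (frac_power (\<lambda>y. y - T y) \<gamma>) \<longrightarrow>
       (\<lambda>t. norm (z x t - z\<^sub>0 x t)) \<in> o[at_top](\<lambda>t. t powr (- \<gamma> / \<alpha>))) \<and>
    \<comment> \<open>(iv)\<close>
    (\<exists>X\<^sub>0. complex_vector.subspace X\<^sub>0 \<and> closure X\<^sub>0 = UNIV \<and>
       (\<forall>x\<in>X\<^sub>0. \<forall>\<gamma>>0. (\<lambda>t. norm (z x t - z\<^sub>0 x t)) \<in> o[at_top](\<lambda>t. t powr (- \<gamma>))))"
proof -
  obtain K\<^sub>0 where K\<^sub>0: "\<And>t s. 0 \<le> s \<Longrightarrow> s \<le> t \<Longrightarrow> onorm (U t s) \<le> K\<^sub>0"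
    using \<open>bounded_family U\<close> unfolding bounded_family_def bdd_above_def by blast
  define K where "K = max 1 K\<^sub>0"
  have U_le: "norm (U t s x) \<le> K * norm x" if "0 \<le> s" "s \<le> t" for t s x
  proof -
    have "bounded_linear (U t s)"
      using \<open>evolution_family U\<close> that by (simp add: evolution_family_def bounded_clinear_linear)
    from onorm[OF this, of x] have "norm (U t s x) \<le> onorm (U t s) * norm x" .
    also have "\<dots> \<le> K * norm x" using K\<^sub>0[OF that] by (intro mult_right_mono) (auto simp: K_def)
    finally show ?thesis .
  qed
  interpret periodic_evolution U \<tau> K
    by unfold_locales (use assms U_le in auto)
  obtain C where C: "C \<ge> 0" "\<And>\<mu> x. cmod \<mu> = 1 \<Longrightarrow> \<mu> \<noteq> 1 \<Longrightarrow>
    norm x \<le> C * cmod (\<mu> - 1) powr (- \<alpha>) * norm (\<mu> *\<^sub>C x - T x)"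
    using resolvent_lower_bound[of T \<alpha>] assms by force
  interpret T: resolvent_growth T K \<alpha> C
  proof
    show "bounded_clinear T" unfolding T_def using \<open>\<tau> > 0\<close> by (intro U_clinear) auto
    show "norm ((T ^^ n) x) \<le> K * norm x" for n x
      unfolding T_def monodromy_pow using \<open>\<tau> > 0\<close> by (intro U_le) auto
  qed (use \<open>\<alpha> \<ge> 1\<close> C in \<open>auto simp: K_def\<close>)
  have A_eq: "(\<lambda>x. x - T x) = T.A" by (auto simp: T.A_def)
  have Z_eq: "Z = T.Z" unfolding Z_def T.Z_def A_eq ..
  have P_eq: "P = T.Pr" unfolding P_def T.Pr_def Z_eq ..
  have diff_eq: "z x t - z\<^sub>0 x t = U t 0 (x - P x)" if "0 \<le> t" for x t
    using that by (simp add: z_def z\<^sub>0_def solution_def bounded_clinear_diff[OF U_clinear])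
  have smallo: "(\<lambda>t. norm (z x t - z\<^sub>0 x t)) \<in> o[at_top](\<lambda>t. t powr (- g))"
    if "g \<ge> 0" "(\<lambda>n. real n powr g * norm ((T ^^ n) (x - P x))) \<longlonglongrightarrow> 0" for g x
  proof -
    have "(\<lambda>t. norm (U t 0 (x - P x))) \<in> o[at_top](\<lambda>t. t powr (- g))"
      using that unfolding T_def by (rule solution_smallo)
    moreover have "\<forall>\<^sub>F t in at_top. norm (U t 0 (x - P x)) = norm (z x t - z\<^sub>0 x t)"
      using eventually_ge_at_top[of 0] by eventually_elim (simp add: diff_eq)
    ultimately show ?thesis by (simp cong: landau_o.small.in_cong)
  qed

  have part_sum: "direct_sum_decomp (Fix T) Z"
    unfolding Z_eq by (rule T.direct_sum_Fix_Z)

  have conv: "((\<lambda>t. norm (z x t - z\<^sub>0 x t)) \<longlongrightarrow> 0) at_top" for x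
  proof (rule Lim_transform_eventually)
    show "((\<lambda>t. norm (U t 0 (x - P x))) \<longlongrightarrow> 0) at_top"
      by (rule solution_tendsto_0)
        (use T.T_pow_tendsto_0[OF T.diff_Pr_mem_Z, of x] in \<open>simp only: P_eq T_def\<close>)
    show "\<forall>\<^sub>F t in at_top. norm (U t 0 (x - P x)) = norm (z x t - z\<^sub>0 x t)"
      using eventually_ge_at_top[of 0] by eventually_elim (simp add: diff_eq)
  qed

  have fix_P: "T (P x) = P x" for x
    using T.Pr_mem_Fix[of x] by (simp add: P_eq Fix_def)
  have per: "periodic_with \<tau> (z\<^sub>0 x)" for x
    unfolding periodic_with_def
  proof (intro conjI allI impI)
    fix t :: real assume t: "t \<ge> 0"
    have "U (t + \<tau>) 0 (P x) = U (t + \<tau>) \<tau> (U \<tau> 0 (P x))"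
      using t \<open>\<tau> > 0\<close> by (simp add: U_comp)
    also have "U (t + \<tau>) \<tau> = U t 0"
      using U_shift[of 0 t 1] t by simp
    finally show "z\<^sub>0 x (t + \<tau>) = z\<^sub>0 x t"
      using fix_P[of x] by (simp add: z\<^sub>0_def solution_def T_def)
  qed (rule \<open>\<tau> > 0\<close>)
  have init: "z\<^sub>0 x 0 = P x" for x
    by (simp add: z\<^sub>0_def solution_def U_refl)

  have asym: "asymptotically_periodic U"
    unfolding asymptotically_periodic_def
  proof
    fix x
    show "\<exists>z\<^sub>0. (\<exists>p. periodic_with p z\<^sub>0) \<and> ((\<lambda>t. norm (solution U x t - z\<^sub>0 t)) \<longlongrightarrow> 0) at_top"
      using conv[of x] per[of x] unfolding z_def by blast
  qed

  have stab: "stable U \<longleftrightarrow> Fix T = {0}"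
  proof
    assume stable: "stable U"
    have "x = 0" if "x \<in> Fix T" for x
    proof -
      have "filterlim (\<lambda>n. real n * \<tau>) at_top sequentially"
        by (rule filterlim_at_top_mult_tendsto_pos[OF tendsto_const \<open>\<tau> > 0\<close> filterlim_real_sequentially])
      moreover have "((\<lambda>t. norm (U t 0 x)) \<longlongrightarrow> 0) at_top"
        using stable by (simp add: stable_def solution_def)
      ultimately have "(\<lambda>n. norm (U (real n * \<tau>) 0 x)) \<longlonglongrightarrow> 0"
        by (rule filterlim_compose[rotated])
      then show ?thesis
        using T.T_pow_Fix[OF that] by (simp add: T_def monodromy_pow LIMSEQ_const_iff)
    qed
    then show "Fix T = {0}"
      using complex_vector.subspace_0[OF T.subspace_Fix] by auto
  next
    assume Fix: "Fix T = {0}"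
    have P_0: "P x = 0" for x using T.Pr_mem_Fix[of x] Fix by (simp add: P_eq)
    have "\<forall>\<^sub>F t in at_top. norm (z x t - z\<^sub>0 x t) = norm (solution U x t)" for x
      using eventually_ge_at_top[of 0] by eventually_elim (simp add: diff_eq solution_def P_0)
    from Lim_transform_eventually[OF conv this] show "stable U"
      unfolding stable_def by blast
  qed

  have exp_iff: "(\<exists>M>0. \<exists>\<beta>>0. \<forall>t\<ge>0. \<forall>x. norm (z x t - z\<^sub>0 x t) \<le> M * exp (- \<beta> * t) * norm x)
       \<longleftrightarrow> closed (range (\<lambda>x. x - T x))"
  proof
    assume "\<exists>M>0. \<exists>\<beta>>0. \<forall>t\<ge>0. \<forall>x. norm (z x t - z\<^sub>0 x t) \<le> M * exp (- \<beta> * t) * norm x"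
    then obtain M \<beta> where \<beta>: "\<beta> > 0"
      and decay: "\<And>t x. t \<ge> 0 \<Longrightarrow> norm (z x t - z\<^sub>0 x t) \<le> M * exp (- \<beta> * t) * norm x" by blast
    have "norm ((T ^^ n) v) \<le> M * exp (- (\<beta> * \<tau>) * real n) * norm v" if "v \<in> T.Z" for n v
    proof -
      have "P v = 0" using T.Pr_of_Z[OF that] by (simp only: P_eq)
      then show ?thesis
        using decay[of "real n * \<tau>" v] \<open>\<tau> > 0\<close> by (simp add: diff_eq T_def monodromy_pow mult_ac)
    qed
    then show "closed (range (\<lambda>x. x - T x))"
      unfolding A_eq using \<beta> \<open>\<tau> > 0\<close> by (intro T.closed_range_if_exponential_decay[of "\<beta> * \<tau>" M]) auto
  next
    assume "closed (range (\<lambda>x. x - T x))"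
    then obtain N where N: "N > 0" and half: "\<And>v. v \<in> T.Z \<Longrightarrow> norm ((T ^^ N) v) \<le> norm v / 2"
      unfolding A_eq using T.contraction_if_closed_range by blast
    define b where "b = ln 2 / real N"
    have b: "b > 0" using N by (simp add: b_def)
    define M where "M = K * (2 * K * exp b * (1 + K))"
    have K1: "K \<ge> 1" by (simp add: K_def)
    have "norm (z x t - z\<^sub>0 x t) \<le> M * exp (- (b / \<tau>) * t) * norm x" if t: "t \<ge> 0" for x t
    proof -
      have "norm (z x t - z\<^sub>0 x t) \<le> K * norm ((T ^^ periods t) (x - P x))"
        unfolding diff_eq[OF t] T_def by (rule norm_solution_le[OF t])
      also have "\<dots> \<le> K * (2 * K * exp (- b * real (periods t)) * norm (x - P x))"
        unfolding P_eq b_def using K1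
        by (intro mult_left_mono T.exponential_decay_of_contraction N half T.diff_Pr_mem_Z) auto
      also have "\<dots> \<le> K * (2 * K * (exp b * exp (- (b / \<tau>) * t)) * ((1 + K) * norm x))"
      proof (intro mult_left_mono mult_mono)
        have "t / \<tau> \<le> real (periods t) + 1"
          using less_Suc_periods[OF t] \<open>\<tau> > 0\<close> by (simp add: field_simps)
        then have "b * (t / \<tau>) \<le> b * (real (periods t) + 1)" using b by (intro mult_left_mono) auto
        then show "exp (- b * real (periods t)) \<le> exp b * exp (- (b / \<tau>) * t)"
          by (simp add: exp_add[symmetric] algebra_simps)
        show "norm (x - P x) \<le> (1 + K) * norm x"
          using norm_triangle_ineq4[of x "P x"] T.norm_Pr_le[of x] by (simp add: P_eq algebra_simps)
      qed (use K1 in auto)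
      finally show ?thesis by (simp only: M_def mult_ac)
    qed
    moreover have "M > 0" using K1 by (simp add: M_def)
    moreover have "b / \<tau> > 0" using b \<open>\<tau> > 0\<close> by simp
    ultimately show "\<exists>M>0. \<exists>\<beta>>0. \<forall>t\<ge>0. \<forall>x. norm (z x t - z\<^sub>0 x t) \<le> M * exp (- \<beta> * t) * norm x"
      by blast
  qed

  have frac: "(\<lambda>t. norm (z x t - z\<^sub>0 x t)) \<in> o[at_top](\<lambda>t. t powr (- \<gamma> / \<alpha>))"
    if \<gamma>: "\<gamma> > 0" and x: "x - P x \<in> range (frac_power (\<lambda>y. y - T y) \<gamma>)" for x \<gamma>
  proof -
    obtain y where y: "x - P x = frac_power T.A \<gamma> y" using x unfolding A_eq by blast
    have "(\<lambda>t. norm (z x t - z\<^sub>0 x t)) \<in> o[at_top](\<lambda>t. t powr (- (\<gamma> / \<alpha>)))"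
    proof (rule smallo)
      show "(\<lambda>n. real n powr (\<gamma> / \<alpha>) * norm ((T ^^ n) (x - P x))) \<longlonglongrightarrow> 0"
        unfolding y by (rule T.frac_power_decay[OF \<gamma>])
    qed (use \<gamma> \<open>\<alpha> \<ge> 1\<close> in simp)
    then show ?thesis by simp
  qed

  \<comment> \<open>The largest candidate. It is dense because it contains \<open>P x + w\<close> whenever \<open>w \<in> Z\<close> lies in
    \<open>A\<^sup>k Z\<close> for every \<open>k\<close>.\<close>
  define X\<^sub>0 where "X\<^sub>0 = {x. \<forall>\<gamma>>0. (\<lambda>t. norm (z x t - z\<^sub>0 x t)) \<in> o[at_top](\<lambda>t. t powr (- \<gamma>))}"
  have P_clinear: "bounded_clinear P" unfolding P_eq by (rule T.Pr_clinear)
  have smallo_mono: "(\<lambda>t. norm (z w t - z\<^sub>0 w t)) \<in> o[at_top](h)"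
    if w: "\<And>t. t \<ge> 0 \<Longrightarrow> norm (z w t - z\<^sub>0 w t) \<le> f t" and f: "f \<in> o[at_top](h)" for w f and h :: "real \<Rightarrow> real"
  proof (rule landau_o.big_small_trans[OF _ f])
    have "\<forall>\<^sub>F t in at_top. norm (norm (z w t - z\<^sub>0 w t)) \<le> norm (f t)"
      using eventually_ge_at_top[of 0]
    proof eventually_elim
      case (elim t)
      show ?case using w[OF elim] by simp
    qed
    then show "(\<lambda>t. norm (z w t - z\<^sub>0 w t)) \<in> O[at_top](f)"
      by (rule landau_o.big_mono)
  qed
  have sub: "complex_vector.subspace X\<^sub>0"
  proof (rule complex_vector.subspaceI)
    show "0 \<in> X\<^sub>0"
      unfolding X\<^sub>0_def
    proof (intro CollectI allI impI)
      show "(\<lambda>t. norm (z 0 t - z\<^sub>0 0 t)) \<in> o[at_top](\<lambda>t. t powr (- \<gamma>))" for \<gamma>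
        by (rule smallo_mono[where f = "\<lambda>t. 0"])
          (simp_all add: diff_eq bounded_clinear_zero[OF P_clinear] bounded_clinear_zero[OF U_clinear])
    qed
    show "x + y \<in> X\<^sub>0" if "x \<in> X\<^sub>0" "y \<in> X\<^sub>0" for x y
      unfolding X\<^sub>0_def
    proof (intro CollectI allI impI)
      fix \<gamma> :: real assume \<gamma>: "\<gamma> > 0"
      show "(\<lambda>t. norm (z (x + y) t - z\<^sub>0 (x + y) t)) \<in> o[at_top](\<lambda>t. t powr (- \<gamma>))"
      proof (rule smallo_mono)
        show "(\<lambda>t. norm (z x t - z\<^sub>0 x t) + norm (z y t - z\<^sub>0 y t)) \<in> o[at_top](\<lambda>t. t powr (- \<gamma>))"
          using that \<gamma> unfolding X\<^sub>0_def by (intro sum_in_smallo) auto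
        fix t :: real assume t: "t \<ge> 0"
        have "U t 0 (x + y - P (x + y)) = U t 0 (x - P x) + U t 0 (y - P y)"
          by (simp only: bounded_clinear_add[OF P_clinear]
              bounded_clinear_add[OF U_clinear[OF order_refl t], symmetric] add_diff_add)
        then show "norm (z (x + y) t - z\<^sub>0 (x + y) t) \<le> norm (z x t - z\<^sub>0 x t) + norm (z y t - z\<^sub>0 y t)"
          using t by (simp add: diff_eq norm_triangle_ineq)
      qed
    qed
    show "c *\<^sub>C x \<in> X\<^sub>0" if "x \<in> X\<^sub>0" for c x
      unfolding X\<^sub>0_def
    proof (intro CollectI allI impI)
      fix \<gamma> :: real assume \<gamma>: "\<gamma> > 0"
      show "(\<lambda>t. norm (z (c *\<^sub>C x) t - z\<^sub>0 (c *\<^sub>C x) t)) \<in> o[at_top](\<lambda>t. t powr (- \<gamma>))"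
      proof (rule smallo_mono)
        show "(\<lambda>t. cmod c * norm (z x t - z\<^sub>0 x t)) \<in> o[at_top](\<lambda>t. t powr (- \<gamma>))"
          using that \<gamma> unfolding X\<^sub>0_def by simp
        fix t :: real assume t: "t \<ge> 0"
        have "c *\<^sub>C x - P (c *\<^sub>C x) = c *\<^sub>C (x - P x)"
          by (simp add: bounded_clinear_scaleC[OF P_clinear] complex_vector.scale_right_diff_distrib)
        then show "norm (z (c *\<^sub>C x) t - z\<^sub>0 (c *\<^sub>C x) t) \<le> cmod c * norm (z x t - z\<^sub>0 x t)"
          using t by (simp add: diff_eq bounded_clinear_scaleC[OF U_clinear] norm_scaleC)
      qed
    qed
  qed
  have dense: "closure X\<^sub>0 = UNIV"
  proof -
    have "x \<in> closure X\<^sub>0" for x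
      unfolding closure_approachable
    proof (intro allI impI)
      fix e :: real assume "e > 0"
      then obtain w where w: "dist w (x - P x) < e" and w_range: "\<And>k. w \<in> (T.A ^^ k) ` T.Z"
        using T.Mittag_Leffler_dense[OF T.diff_Pr_mem_Z] unfolding P_eq by blast
      have "w \<in> T.Z" using w_range[of 0] by simp
      then have P_eq_Px: "P (P x + w) = P x"
        unfolding P_eq by (intro T.Pr_eqI T.Pr_mem_Fix) simp
      have "P x + w \<in> X\<^sub>0"
        unfolding X\<^sub>0_def
      proof (intro CollectI allI impI)
        fix \<gamma> :: real assume \<gamma>: "\<gamma> > 0"
        define k where "k = nat \<lceil>\<gamma> * \<alpha>\<rceil>"
        obtain v where v: "v \<in> T.Z" "w = (T.A ^^ k) v" using w_range[of k] by blast
        have stable_part: "P x + w - P (P x + w) = (T.A ^^ k) v"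
          unfolding P_eq_Px using v(2) by simp
        have "\<gamma> * \<alpha> \<le> real k" unfolding k_def by linarith
        then have k: "\<gamma> \<le> real k / \<alpha>" using \<open>\<alpha> \<ge> 1\<close> by (simp add: field_simps)
        show "(\<lambda>t. norm (z (P x + w) t - z\<^sub>0 (P x + w) t)) \<in> o[at_top](\<lambda>t. t powr (- \<gamma>))"
        proof (rule smallo)
          show "(\<lambda>n. real n powr \<gamma> * norm ((T ^^ n) (P x + w - P (P x + w)))) \<longlonglongrightarrow> 0"
          proof (rule Lim_null_comparison[OF _ T.A_pow_decay[OF v(1), of k]])
            show "\<forall>\<^sub>F n in sequentially. norm (real n powr \<gamma> * norm ((T ^^ n) (P x + w - P (P x + w))))
              \<le> real n powr (real k / \<alpha>) * norm ((T ^^ n) ((T.A ^^ k) v))"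
              using eventually_ge_at_top[of 1]
              by eventually_elim (use k in \<open>auto simp: stable_part intro!: mult_right_mono powr_mono\<close>)
          qed
        qed (use \<gamma> in simp)
      qed
      moreover have "dist (P x + w) x < e" using w by (simp add: dist_norm algebra_simps)
      ultimately show "\<exists>y\<in>X\<^sub>0. dist y x < e" by blast
    qed
    then show ?thesis by blast
  qed
  have rapid: "\<exists>X\<^sub>0. complex_vector.subspace X\<^sub>0 \<and> closure X\<^sub>0 = UNIV \<and>
       (\<forall>x\<in>X\<^sub>0. \<forall>\<gamma>>0. (\<lambda>t. norm (z x t - z\<^sub>0 x t)) \<in> o[at_top](\<lambda>t. t powr (- \<gamma>)))"
    by (intro exI[of _ X\<^sub>0] conjI sub dense) (simp add: X\<^sub>0_def)
  show ?thesis
    by (intro conjI allI impI part_sum conv per init asym stab exp_iff rapid) (rule frac)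
qed

end
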